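(* Let $f:\mathbb R^{n_1\times\cdots\times n_d}\to\mathbb R$ be smooth, let $\mathbf r=(r_1,\dots,r_d)$ with $1\le r_k\le n_k$, and let $\tilde g=f\circ\tilde\varphi$ on $\mathcal M^{\mathrm{Tucker}}$ and $g=f\circ\varphi$ on $\mathcal M$ (all defined in the context). If $(\tilde{\mathcal G},\tilde{\mathbf U}_1,\dots,\tilde{\mathbf U}_d)\in\mathcal M^{\mathrm{Tucker}}$ is first-order stationary for $\tilde g$, then the point $x\in\mathcal M$ represented by $(\tilde{\mathcal G}\times_{k=1}^d\mathbf R_k^{-1},\tilde{\mathbf U}_1\mathbf R_1,\dots,\tilde{\mathbf U}_d\mathbf R_d)$ is first-order stationary for $g$, where $\mathbf R_k\in\mathrm{GL}(r_k)$ satisfies $\tilde{\mathbf U}_k\mathbf R_k\in\mathrm{St}(r_k,n_k)$ for $k=1,\dots,d$. Furthermore, $\varphi(S_1)=\tilde\varphi(\tilde S_1)$, where $S_1\subseteq\mathcal M$ is the set of all first-order stationary points of $g$ and $\tilde S_1\subseteq\mathcal M^{\mathrm{Tucker}}$ is the set of all first-order stationary points of $\tilde g$.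
   Context: $\mathrm{Sym}(n)$: real symmetric $n\times n$ matrices. $\mathrm{Gr}(s,n)=\{\mathbf P\in\mathrm{Sym}(n):\mathrm{rank}(\mathbf P)=s,\mathbf P=\mathbf P^2\}$. $\mathrm{St}(r,n)=\{\mathbf U\in\mathbb R^{n\times r}:\mathbf U^\top\mathbf U=\mathbf I_r\}$. $\mathrm{GL}(r)$: invertible $r\times r$ real matrices. The $k$-mode product $\mathcal X\times_k\mathbf A$ ($\mathbf A\in\mathbb R^{M\times n_k}$) has entries $\sum_{i_k}\mathbf A(j,i_k)\mathcal X(i_1,\dots,i_d)$; $\times_{k=1}^d$ denotes successive products over all modes. $\mathcal M=\{(\mathcal X,\mathbf P_1,\dots,\mathbf P_d):\mathcal X\in\mathbb R^{n_1\times\cdots\times n_d},\ \mathbf P_k\in\mathrm{Gr}(n_k-r_k,n_k),\ \mathcal X\times_k\mathbf P_k=0\ \forall k\}$, an embedded submanifold of $\mathcal E=\mathbb R^{n_1\times\cdots\times n_d}\times\mathrm{Sym}(n_1)\times\cdots\times\mathrm{Sym}(n_d)$, with the Riemannian metric induced by the Euclidean (sum of Frobenius) inner product of $\mathcal E$, and $\varphi(\mathcal X,\mathbf P_1,\dots,\mathbf P_d)=\mathcal X$. The point of $\mathcal M$ represented by $(\mathcal G,\mathbf U_1,\dots,\mathbf U_d)$, $\mathcal G\in\mathbb R^{r_1\times\cdots\times r_d}$, $\mathbf U_k\in\mathrm{St}(r_k,n_k)$, is given by $\mathcal X=\mathcal G\times_{k=1}^d\mathbf U_k$, $\mathbf P_k=\mathbf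 I_{n_k}-\mathbf U_k\mathbf U_k^\top$. A point $x\in\mathcal M$ is first-order stationary for $g$ if the Riemannian gradient satisfies $\mathrm{grad}\,g(x)=0$. $\mathcal M^{\mathrm{Tucker}}=\mathbb R^{r_1\times\cdots\times r_d}\times\mathbb R^{n_1\times r_1}\times\cdots\times\mathbb R^{n_d\times r_d}$ (Euclidean space) with $\tilde\varphi(\tilde{\mathcal G},\tilde{\mathbf U}_1,\dots,\tilde{\mathbf U}_d)=\tilde{\mathcal G}\times_{k=1}^d\tilde{\mathbf U}_k$; a point is first-order stationary for $\tilde g$ if $\nabla\tilde g=0$ there.
   Formalization: In the equality of images, the set of stationary points of g̃ is restricted to those whose factors Ũ_k all have full column rank r_k; without this it fails, e.g. d=n_1=r_1=1, f(X)=X, where (0,0) is stationary for g̃ but g has no stationary point. *)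

theory Defs
  imports
    "HOL-Analysis.Analysis"
    "Jordan_Normal_Form.DL_Rank"
    "Jordan_Normal_Form.Gauss_Jordan_Elimination"
begin

hide_const (open) Finite_Cartesian_Product.mat

section \<open>Tensors\<close>

text \<open>
  A multi-index is a list of naturals (modes and indices count from 0). A tensor of size
  \<open>ns = [n\<^sub>1, \<dots>, n\<^sub>d]\<close> is a real function on multi-indices that vanishes outside the
  index box of \<open>ns\<close>; the order \<open>d\<close> is \<open>length ns\<close>. Extending by zero makes equality of
  tensors equality of functions, and vector space operations pointwise.
\<close>

type_synonym tensor = "nat list \<Rightarrow> real"

definition index_box :: "nat list \<Rightarrow> nat list set" where
  "index_box ns = {i. length i = length ns \<and> (\<forall>k<length ns. i ! k < ns ! k)}"

definition tensors :: "nat list \<Rightarrow> tensor set" where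
  "tensors ns = {X. \<forall>i. i \<notin> index_box ns \<longrightarrow> X i = 0}"

text \<open>
  The \<open>k\<close>-mode product. If \<open>X\<close> has size \<open>ns\<close> and \<open>dim_col A = ns ! k\<close>, the result has size
  \<open>ns[k := dim_row A]\<close>; it vanishes outside that box because \<open>X\<close> vanishes outside its own.
\<close>

definition mode_prod :: "tensor \<Rightarrow> nat \<Rightarrow> real mat \<Rightarrow> tensor" where
  "mode_prod X k A = (\<lambda>i. if k < length i \<and> i ! k < dim_row A
     then \<Sum>l<dim_col A. A $$ (i ! k, l) * X (i[k := l]) else 0)"

definition multi_mode_prod :: "tensor \<Rightarrow> real mat list \<Rightarrow> tensor" where
  "multi_mode_prod X As = fold (\<lambda>k Y. mode_prod Y k (As ! k)) [0..<length As] X"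

section \<open>Matrix sets\<close>

definition Gr :: "nat \<Rightarrow> nat \<Rightarrow> real mat set" where
  "Gr s n = {P \<in> carrier_mat n n. transpose_mat P = P \<and> vec_space.rank n P = s \<and> P = P * P}"

definition St :: "nat \<Rightarrow> nat \<Rightarrow> real mat set" where
  "St r n = {U \<in> carrier_mat n r. transpose_mat U * U = 1\<^sub>m r}"

definition GL :: "nat \<Rightarrow> real mat set" where
  "GL r = {A \<in> carrier_mat r r. invertible_mat A}"

definition inv_mat :: "real mat \<Rightarrow> real mat" where
  "inv_mat A = the (mat_inverse A)"

section \<open>Smooth functions on the space of tensors\<close>

text \<open>
  \<open>Ck_on m ns F\<close>: all partial derivatives of \<open>F\<close> up to order \<open>m\<close> exist and are continuous on
  the space of tensors of size \<open>ns\<close>. The function type carries the product topology, which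
  induces the Euclidean topology on \<open>tensors ns\<close>. Only the values of \<open>F\<close> on \<open>tensors ns\<close>
  matter. Varying the entry of \<open>X\<close> at \<open>i\<close> is the function update \<open>X(i := t)\<close>.
\<close>

primrec Ck_on :: "nat \<Rightarrow> nat list \<Rightarrow> (tensor \<Rightarrow> real) \<Rightarrow> bool" where
  "Ck_on 0 ns F \<longleftrightarrow> continuous_on (tensors ns) F"
| "Ck_on (Suc m) ns F \<longleftrightarrow> continuous_on (tensors ns) F \<and>
     (\<forall>i\<in>index_box ns. \<exists>F'.
        (\<forall>X\<in>tensors ns. ((\<lambda>t. F (X(i := t))) has_real_derivative F' X) (at (X i))) \<and>
        Ck_on m ns F')"

definition smooth_on_tensors :: "nat list \<Rightarrow> (tensor \<Rightarrow> real) \<Rightarrow> bool" where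
  "smooth_on_tensors ns F \<longleftrightarrow> (\<forall>m. Ck_on m ns F)"

section \<open>The manifold\<close>

text \<open>
  A pair \<open>(X, Ps)\<close> with \<open>X \<in> tensors ns\<close> and \<open>Ps ! k\<close> a symmetric matrix of size \<open>ns ! k\<close> is an
  element of the ambient Euclidean space; \<open>inner_E\<close> is the sum of the Frobenius inner products.
\<close>

type_synonym point = "tensor \<times> real mat list"

definition manifold :: "nat list \<Rightarrow> nat list \<Rightarrow> point set" where
  "manifold ns rs = {(X, Ps). X \<in> tensors ns \<and> length Ps = length ns \<and>
     (\<forall>k<length ns. Ps ! k \<in> Gr (ns ! k - rs ! k) (ns ! k) \<and> mode_prod X k (Ps ! k) = (\<lambda>i. 0))}"

definition phi :: "point \<Rightarrow> tensor" where
  "phi = fst"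

definition inner_E :: "nat list \<Rightarrow> point \<Rightarrow> point \<Rightarrow> real" where
  "inner_E ns v w = (\<Sum>i\<in>index_box ns. fst v i * fst w i) +
     (\<Sum>k<length ns. \<Sum>a<ns ! k. \<Sum>b<ns ! k. (snd v ! k) $$ (a, b) * (snd w ! k) $$ (a, b))"

definition zero_E :: "nat list \<Rightarrow> point" where
  "zero_E ns = ((\<lambda>i. 0), map (\<lambda>n. 0\<^sub>m n n) ns)"

definition smooth_real_on :: "real set \<Rightarrow> (real \<Rightarrow> real) \<Rightarrow> bool" where
  "smooth_real_on S h \<longleftrightarrow> (\<forall>m. \<forall>t\<in>S. ((deriv ^^ m) h) field_differentiable (at t))"

text \<open>\<open>c\<close> is, near 0, a smooth curve in the manifold passing through \<open>x\<close> at time 0.\<close>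

definition curve_through :: "nat list \<Rightarrow> nat list \<Rightarrow> point \<Rightarrow> (real \<Rightarrow> point) \<Rightarrow> bool" where
  "curve_through ns rs x c \<longleftrightarrow> c 0 = x \<and>
     (\<exists>\<epsilon>>0. (\<forall>t\<in>{-\<epsilon><..<\<epsilon>}. c t \<in> manifold ns rs) \<and>
        (\<forall>i\<in>index_box ns. smooth_real_on {-\<epsilon><..<\<epsilon>} (\<lambda>t. fst (c t) i)) \<and>
        (\<forall>k<length ns. \<forall>a<ns ! k. \<forall>b<ns ! k.
           smooth_real_on {-\<epsilon><..<\<epsilon>} (\<lambda>t. (snd (c t) ! k) $$ (a, b))))"

definition velocity :: "nat list \<Rightarrow> (real \<Rightarrow> point) \<Rightarrow> point" where
  "velocity ns c =
     ((\<lambda>i. if i \<in> index_box ns then deriv (\<lambda>t. fst (c t) i) 0 else 0),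
      map (\<lambda>k. Matrix.mat (ns ! k) (ns ! k) (\<lambda>(a, b). deriv (\<lambda>t. (snd (c t) ! k) $$ (a, b)) 0))
        [0..<length ns])"

definition tangent_space :: "nat list \<Rightarrow> nat list \<Rightarrow> point \<Rightarrow> point set" where
  "tangent_space ns rs x = {velocity ns c | c. curve_through ns rs x c}"

text \<open>
  \<open>v\<close> is the Riemannian gradient of \<open>g\<close> at \<open>x\<close>: a tangent vector representing the differential
  \<open>D g(x)[c'(0)] = (g \<circ> c)'(0)\<close> with respect to the metric induced by \<open>inner_E\<close>. Such a \<open>v\<close> is
  unique, as shown below.
\<close>

definition has_riemannian_gradient ::
  "nat list \<Rightarrow> nat list \<Rightarrow> (point \<Rightarrow> real) \<Rightarrow> point \<Rightarrow> point \<Rightarrow> bool" where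
  "has_riemannian_gradient ns rs g x v \<longleftrightarrow> v \<in> tangent_space ns rs x \<and>
     (\<forall>c. curve_through ns rs x c \<longrightarrow>
        ((\<lambda>t. g (c t)) has_real_derivative inner_E ns v (velocity ns c)) (at 0))"

lemma finite_index_box: "finite (index_box ns)"
proof (rule finite_subset)
  show "index_box ns \<subseteq> {xs. set xs \<subseteq> {..<Suc (sum_list ns)} \<and> length xs = length ns}"
  proof clarsimp
    fix i :: "nat list"
    assume i: "i \<in> index_box ns"
    then have l: "length i = length ns" by (simp add: index_box_def)
    moreover have "j < Suc (sum_list ns)" if j: "j \<in> set i" for j
    proof -
      obtain k where k: "k < length i" "j = i ! k" using j by (metis in_set_conv_nth)
      then have "j < ns ! k" using i by (auto simp: index_box_def)
      moreover have "ns ! k \<le> sum_list ns" using k l by (simp add: elem_le_sum_list)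
      ultimately show ?thesis by simp
    qed
    ultimately show "set i \<subseteq> {..<Suc (sum_list ns)} \<and> length i = length ns" by auto
  qed
  show "finite {xs. set xs \<subseteq> {..<Suc (sum_list ns)} \<and> length xs = length ns}"
    by (rule finite_lists_length_eq) simp
qed

lemma riemannian_gradient_unique:
  assumes v: "has_riemannian_gradient ns rs g x v"
    and w: "has_riemannian_gradient ns rs g x w"
  shows "v = w"
proof -
  obtain cv cw where cv: "curve_through ns rs x cv" "v = velocity ns cv"
    and cw: "curve_through ns rs x cw" "w = velocity ns cw"
    using v w by (auto simp: has_riemannian_gradient_def tangent_space_def)
  have eq: "inner_E ns v (velocity ns c) = inner_E ns w (velocity ns c)"
    if "curve_through ns rs x c" for c
    using v w that by (blast intro: DERIV_unique[of "\<lambda>t. g (c t)"]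
        dest: has_riemannian_gradient_def[THEN iffD1])
  let ?p = "\<lambda>k a b. (snd v ! k) $$ (a, b) - (snd w ! k) $$ (a, b)"
  have "(\<Sum>i\<in>index_box ns. (fst v i - fst w i)\<^sup>2) + (\<Sum>k<length ns. \<Sum>a<ns ! k. \<Sum>b<ns ! k. (?p k a b)\<^sup>2)
      = inner_E ns v v - inner_E ns w v - (inner_E ns v w - inner_E ns w w)"
    unfolding inner_E_def
    by (simp add: power2_eq_square algebra_simps sum.distrib sum_subtractf sum_distrib_left)
  also have "\<dots> = 0" using eq[OF cv(1)] eq[OF cw(1)] cv(2) cw(2) by simp
  finally have "(\<Sum>i\<in>index_box ns. (fst v i - fst w i)\<^sup>2) = 0 \<and>
      (\<Sum>k<length ns. \<Sum>a<ns ! k. \<Sum>b<ns ! k. (?p k a b)\<^sup>2) = 0"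
    by (subst (asm) add_nonneg_eq_0_iff) (auto intro!: sum_nonneg)
  then have X: "fst v i = fst w i" if "i \<in> index_box ns" for i
    using that finite_index_box by (simp add: sum_nonneg_eq_0_iff)
  have P: "(snd v ! k) $$ (a, b) = (snd w ! k) $$ (a, b)"
    if "k < length ns" "a < ns ! k" "b < ns ! k" for k a b
    using \<open>_ \<and> _\<close> that by (simp add: sum_nonneg_eq_0_iff sum_nonneg)
  show ?thesis
  proof (rule prod_eqI)
    show "fst v = fst w" using X cv(2) cw(2) by (auto simp: velocity_def fun_eq_iff)
    show "snd v = snd w"
    proof (rule nth_equalityI)
      show "length (snd v) = length (snd w)" using cv(2) cw(2) by (simp add: velocity_def)
      fix k assume "k < length (snd v)"
      then have k: "k < length ns" using cv(2) by (simp add: velocity_def)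
      then show "snd v ! k = snd w ! k"
        using P[OF k] cv(2) cw(2) by (intro eq_matI) (auto simp: velocity_def)
    qed
  qed
qed

definition stationary_points :: "nat list \<Rightarrow> nat list \<Rightarrow> (point \<Rightarrow> real) \<Rightarrow> point set" where
  "stationary_points ns rs g =
     {x \<in> manifold ns rs. has_riemannian_gradient ns rs g x (zero_E ns)}"

definition represented_point :: "tensor \<Rightarrow> real mat list \<Rightarrow> point" where
  "represented_point G Us =
     (multi_mode_prod G Us, map (\<lambda>U. 1\<^sub>m (dim_row U) - U * transpose_mat U) Us)"

section \<open>The Tucker parametrization\<close>

definition tucker_space :: "nat list \<Rightarrow> nat list \<Rightarrow> point set" where
  "tucker_space ns rs = {(G, Us). G \<in> tensors rs \<and> length Us = length ns \<and>
     (\<forall>k<length ns. Us ! k \<in> carrier_mat (ns ! k) (rs ! k))}"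

definition tucker_phi :: "point \<Rightarrow> tensor" where
  "tucker_phi = (\<lambda>(G, Us). multi_mode_prod G Us)"

text \<open>
  \<open>(G', Us')\<close> is the Euclidean gradient of \<open>h\<close> at \<open>(G, Us)\<close>, that is, the vector of all its
  partial derivatives.
\<close>

definition has_tucker_gradient ::
  "nat list \<Rightarrow> nat list \<Rightarrow> (point \<Rightarrow> real) \<Rightarrow> point \<Rightarrow> point \<Rightarrow> bool" where
  "has_tucker_gradient ns rs h = (\<lambda>(G, Us) (G', Us').
     (G', Us') \<in> tucker_space ns rs \<and>
     (\<forall>i\<in>index_box rs. ((\<lambda>t. h (G(i := t), Us)) has_real_derivative G' i) (at (G i))) \<and>
     (\<forall>k<length ns. \<forall>a<ns ! k. \<forall>b<rs ! k.
        ((\<lambda>t. h (G, Us[k := update_mat (Us ! k) (a, b) t]))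
           has_real_derivative (Us' ! k) $$ (a, b)) (at ((Us ! k) $$ (a, b)))))"

definition tucker_stationary_points ::
  "nat list \<Rightarrow> nat list \<Rightarrow> (point \<Rightarrow> real) \<Rightarrow> point set" where
  "tucker_stationary_points ns rs h = {y \<in> tucker_space ns rs.
     has_tucker_gradient ns rs h y
       ((\<lambda>i. 0), map (\<lambda>k. 0\<^sub>m (ns ! k) (rs ! k)) [0..<length ns])}"

text \<open>
  All factor matrices have full column rank. This holds exactly when there are invertible
  \<open>R\<^sub>k\<close> such that every \<open>U\<^sub>k R\<^sub>k\<close> has orthonormal columns, that is, exactly when the Tucker
  point represents points of the manifold. Rank-deficient stationary points such as the origin
  need not correspond to any stationary point on the manifold; the lemma below is an instance.
\<close>

definition full_rank_factors :: "nat list \<Rightarrow> nat list \<Rightarrow> point set" where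
  "full_rank_factors ns rs = {(G, Us) \<in> tucker_space ns rs.
     \<forall>k<length ns. vec_space.rank (ns ! k) (Us ! k) = rs ! k}"

lemma rank_deficient_counterexample:
  defines "f \<equiv> \<lambda>X::tensor. X [0]"
  shows "smooth_on_tensors [1] f"
    and "((\<lambda>i. 0), [0\<^sub>m 1 1]) \<in> tucker_stationary_points [1] [1] (f \<circ> tucker_phi)"
    and "stationary_points [1] [1] (f \<circ> phi) = {}"
proof -
  have box: "index_box [1] = {[0]}" "index_box [Suc 0] = {[0]}"
    by (auto simp: index_box_def length_Suc_conv)
  have const: "Ck_on m [1] (\<lambda>X. a)" for m a
    by (induction m arbitrary: a) (auto intro!: exI[of _ "\<lambda>X. 0"])
  have cont: "continuous_on S f" for S
    unfolding f_def by (rule continuous_on_subset[OF continuous_on_product_coordinates]) simp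
  have "Ck_on m [1] f" for m
  proof (cases m)
    case 0
    then show ?thesis by (simp add: cont)
  next
    case (Suc m')
    have D: "\<forall>X\<in>tensors [1]. ((\<lambda>t. f (X([0] := t))) has_real_derivative 1) (at (X [0]))"
      by (auto simp: f_def)
    show ?thesis
      unfolding Suc Ck_on.simps box
      by (intro conjI cont ballI exI[of _ "\<lambda>X. 1"] const) (use D in auto)
  qed
  then show "smooth_on_tensors [1] f" by (simp add: smooth_on_tensors_def)
  have mp: "multi_mode_prod G [A] [0] = A $$ (0, 0) * G [0]" if "A \<in> carrier_mat 1 1" for G A
    using that by (simp add: multi_mode_prod_def mode_prod_def)
  show "((\<lambda>i. 0), [0\<^sub>m 1 1]) \<in> tucker_stationary_points [1] [1] (f \<circ> tucker_phi)"
    by (auto simp: tucker_stationary_points_def has_tucker_gradient_def tucker_space_def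
        tensors_def box f_def tucker_phi_def mp update_mat_def)
  show "stationary_points [1] [1] (f \<circ> phi) = {}"
  proof (rule ccontr)
    assume "stationary_points [1] [1] (f \<circ> phi) \<noteq> {}"
    then obtain X Ps where x: "(X, Ps) \<in> manifold [1] [1]"
      and g: "has_riemannian_gradient [1] [1] (f \<circ> phi) (X, Ps) (zero_E [1])"
      by (auto simp: stationary_points_def)
    from x obtain P where Ps: "Ps = [P]" and P: "P \<in> Gr 0 1" and X: "X \<in> tensors [1]"
      by (auto simp: manifold_def length_Suc_conv)
    have PC: "P \<in> carrier_mat 1 1" "vec_space.rank 1 P = 0" using P by (auto simp: Gr_def)
    then have "det P = 0" using vec_space.det_rank_iff[of P 1] by auto
    then have P0: "P $$ (0, 0) = 0" using PC(1) by (simp add: det_single)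
    define c where "c = (\<lambda>t. ((X([0] := X [0] + t)), [P]))"
    have c0: "c 0 = (X, Ps)" by (simp add: c_def Ps)
    have cM: "c t \<in> manifold [1] [1]" for t
      using X P PC(1) P0 by (auto simp: c_def manifold_def tensors_def box mode_prod_def)
    have aff: "\<exists>a' b'. (deriv ^^ m) (\<lambda>t. a + b * t) = (\<lambda>t. a' + b' * t)" for m and a b :: real
    proof (induction m)
      case 0
      show ?case by auto
    next
      case (Suc m)
      then obtain a' b' where "(deriv ^^ m) (\<lambda>t. a + b * t) = (\<lambda>t. a' + b' * t)" by blast
      moreover have "deriv (\<lambda>t. a' + b' * t) = (\<lambda>t. b' + 0 * t)"
        by (rule ext, rule DERIV_imp_deriv) (auto intro!: derivative_eq_intros)
      ultimately have "(deriv ^^ Suc m) (\<lambda>t. a + b * t) = (\<lambda>t. b' + 0 * t)" by simp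
      then show ?case by blast
    qed
    have aff': "smooth_real_on S (\<lambda>t. a + b * t)" for S and a b :: real
      unfolding smooth_real_on_def
    proof (intro allI ballI)
      fix m t
      obtain a' b' where "(deriv ^^ m) (\<lambda>t. a + b * t) = (\<lambda>t. a' + b' * t)" using aff by blast
      then show "(deriv ^^ m) (\<lambda>t. a + b * t) field_differentiable (at t)"
        by (auto intro!: derivative_intros)
    qed
    have "curve_through [1] [1] (X, Ps) c"
      unfolding curve_through_def
    proof (intro conjI c0 exI[of _ 1])
      show "\<forall>i\<in>index_box [1]. smooth_real_on {- 1<..<1} (\<lambda>t. fst (c t) i)"
        using aff'[of _ "X [0]" 1] by (simp add: box c_def)
      show "\<forall>k<length [1]. \<forall>a<[1] ! k. \<forall>b<[1] ! k.
          smooth_real_on {- 1<..<1} (\<lambda>t. (snd (c t) ! k) $$ (a, b))"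
        using aff'[of _ "P $$ (0, 0)" 0] by (simp add: c_def)
    qed (use cM in auto)
    then have "((\<lambda>t. (f \<circ> phi) (c t)) has_real_derivative
        inner_E [1] (zero_E [1]) (velocity [1] c)) (at 0)"
      using g by (simp add: has_riemannian_gradient_def)
    then have "((\<lambda>t. X [0] + t) has_real_derivative 0) (at 0)"
      by (simp add: c_def f_def phi_def inner_E_def zero_E_def)
    moreover have "((\<lambda>t. X [0] + t) has_real_derivative 1) (at 0)"
      by (auto intro!: derivative_eq_intros)
    ultimately show False using DERIV_unique by fastforce
  qed
qed

end

theory Submission
  imports Defs
begin

text \<open>
  Let \<open>X = G \<times> U\<close> with all \<open>U\<^sub>k\<close> of full column rank, let \<open>W\<^sub>k\<close> be the left inverse of \<open>U\<^sub>k\<close> for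
  which \<open>Q\<^sub>k = U\<^sub>k W\<^sub>k\<close> is an orthogonal projection, and put \<open>P\<^sub>k = I - Q\<^sub>k\<close>. Stationarity of the
  Tucker point says that \<open>D f(X)\<close> vanishes on all tensors \<open>H \<times> U\<close> and on all tensors obtained
  from \<open>G \<times> U\<close> by replacing one factor \<open>U\<^sub>k\<close> by an arbitrary \<open>V\<close>.

  Differentiating \<open>X \<times>\<^sub>k P\<^sub>k = 0\<close> along a curve in the manifold gives
  \<open>X' = X' \<times>\<^sub>k Q\<^sub>k - X \<times>\<^sub>k P\<^sub>k'\<close>. The last term is a change of the factor \<open>U\<^sub>k\<close>, so \<open>D f(X)\<close> does
  not distinguish \<open>X'\<close> from \<open>X' \<times>\<^sub>k Q\<^sub>k\<close>; applying this in all modes turns \<open>X'\<close> into a tensor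
  \<open>H \<times> U\<close>. Hence Tucker stationarity implies stationarity on the manifold.

  Conversely, moving \<open>G\<close> with the \<open>P\<^sub>k\<close> fixed realizes the directions \<open>H \<times> U\<close>. For the factors it
  is enough to replace \<open>U\<^sub>k\<close> by a matrix unit \<open>E = P\<^sub>k E + U\<^sub>k (W\<^sub>k E)\<close>: the second summand is again a
  change of \<open>G\<close>, and the first is up to scale the velocity of rotating \<open>U\<^sub>k\<close> in the plane spanned
  by a column of \<open>P\<^sub>k\<close> and a row of \<open>W\<^sub>k\<close>.
\<close>

section \<open>Mode products\<close>

text \<open>Stopping after the first \<open>m\<close> modes makes induction over the modes
  possible.\<close>

definition partial_mode_prod :: "nat \<Rightarrow> tensor \<Rightarrow> real mat list \<Rightarrow> tensor" where
  "partial_mode_prod m X As = fold (\<lambda>k Y. mode_prod Y k (As ! k)) [0..<m] X"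

lemma multi_mode_prod_eq_partial:
  "multi_mode_prod X As = partial_mode_prod (length As) X As"
  by (simp add: multi_mode_prod_def partial_mode_prod_def)

lemma partial_mode_prod_0 [simp]: "partial_mode_prod 0 X As = X"
  by (simp add: partial_mode_prod_def)

lemma partial_mode_prod_Suc [simp]:
  "partial_mode_prod (Suc m) X As = mode_prod (partial_mode_prod m X As) m (As ! m)"
  by (simp add: partial_mode_prod_def)

lemma partial_mode_prod_cong:
  "(\<And>k. k < m \<Longrightarrow> As ! k = Bs ! k) \<Longrightarrow> partial_mode_prod m X As = partial_mode_prod m X Bs"
  by (induction m) auto

lemma mode_prod_mult:
  assumes "dim_col B = dim_row A"
  shows "mode_prod (mode_prod X k A) k B = mode_prod X k (B * A)"
proof
  fix i
  show "mode_prod (mode_prod X k A) k B i = mode_prod X k (B * A) i"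
  proof (cases "k < length i \<and> i ! k < dim_row B")
    case True
    then have "mode_prod (mode_prod X k A) k B i =
        (\<Sum>l<dim_col B. \<Sum>j<dim_col A. B $$ (i ! k, l) * (A $$ (l, j) * X (i[k := j])))"
      using assms by (simp add: mode_prod_def sum_distrib_left)
    also have "\<dots> = (\<Sum>j<dim_col A. (\<Sum>l<dim_col B. B $$ (i ! k, l) * A $$ (l, j)) * X (i[k := j]))"
      by (subst sum.swap) (simp add: sum_distrib_right mult.assoc)
    also have "\<dots> = mode_prod X k (B * A) i"
      using True assms by (simp add: mode_prod_def scalar_prod_def atLeast0LessThan)
    finally show ?thesis .
  qed (auto simp: mode_prod_def)
qed

lemma mode_prod_commute:
  assumes "j \<noteq> k"
  shows "mode_prod (mode_prod X j A) k B = mode_prod (mode_prod X k B) j A"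
proof
  fix i
  show "mode_prod (mode_prod X j A) k B i = mode_prod (mode_prod X k B) j A i"
  proof (cases "k < length i \<and> i ! k < dim_row B \<and> j < length i \<and> i ! j < dim_row A")
    case True
    then have "mode_prod (mode_prod X j A) k B i =
        (\<Sum>l<dim_col B. \<Sum>m<dim_col A. B $$ (i ! k, l) * (A $$ (i ! j, m) * X (i[k := l, j := m])))"
      using assms by (simp add: mode_prod_def sum_distrib_left)
    also have "\<dots> = (\<Sum>m<dim_col A. \<Sum>l<dim_col B. A $$ (i ! j, m) * (B $$ (i ! k, l) * X (i[j := m, k := l])))"
      by (subst sum.swap) (simp add: list_update_swap[OF assms] mult.left_commute)
    also have "\<dots> = mode_prod (mode_prod X k B) j A i"
      using True assms by (simp add: mode_prod_def sum_distrib_left)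
    finally show ?thesis .
  qed (use assms in \<open>auto simp: mode_prod_def\<close>)
qed

lemma mode_prod_lincomb_left:
  "mode_prod (\<lambda>i. a * X i + b * Y i) k A = (\<lambda>i. a * mode_prod X k A i + b * mode_prod Y k A i)"
  by (auto simp: mode_prod_def fun_eq_iff sum.distrib sum_distrib_left algebra_simps)

lemma mode_prod_add_right:
  assumes "A \<in> carrier_mat m n" "B \<in> carrier_mat m n"
  shows "mode_prod X k (A + B) = (\<lambda>i. mode_prod X k A i + mode_prod X k B i)"
  using assms by (auto simp: mode_prod_def fun_eq_iff sum.distrib algebra_simps)

lemma mode_prod_smult_right:
  "mode_prod X k (c \<cdot>\<^sub>m A) = (\<lambda>i. c * mode_prod X k A i)"
  by (auto simp: mode_prod_def fun_eq_iff sum_distrib_left algebra_simps)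

lemma mode_prod_zero_right: "mode_prod X k (0\<^sub>m m n) = (\<lambda>i. 0)"
  by (auto simp: mode_prod_def fun_eq_iff)

lemma partial_mode_prod_lincomb:
  "partial_mode_prod m (\<lambda>i. a * X i + b * Y i) As
    = (\<lambda>i. a * partial_mode_prod m X As i + b * partial_mode_prod m Y As i)"
  by (induction m) (simp_all add: mode_prod_lincomb_left)

lemma partial_mode_prod_add:
  "partial_mode_prod m (\<lambda>i. X i + Y i) As
    = (\<lambda>i. partial_mode_prod m X As i + partial_mode_prod m Y As i)"
  using partial_mode_prod_lincomb[of m 1 X 1 Y As] by simp

lemma partial_mode_prod_smult:
  "partial_mode_prod m (\<lambda>i. c * X i) As = (\<lambda>i. c * partial_mode_prod m X As i)"
  using partial_mode_prod_lincomb[of m c X 0 X As] by simp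

lemma mode_prod_one:
  assumes "X \<in> tensors ns" "k < length ns"
  shows "mode_prod X k (1\<^sub>m (ns ! k)) = X"
proof
  fix i
  show "mode_prod X k (1\<^sub>m (ns ! k)) i = X i"
  proof (cases "k < length i \<and> i ! k < ns ! k")
    case True
    then show ?thesis by (simp add: mode_prod_def mult_delta_left)
  next
    case False
    then show ?thesis using assms by (auto simp: mode_prod_def tensors_def index_box_def)
  qed
qed

lemma list_update_in_index_box:
  "i \<in> index_box ns \<Longrightarrow> l < ns ! k \<Longrightarrow> i[k := l] \<in> index_box ns"
  by (cases "k < length i") (auto simp: index_box_def nth_list_update)

lemma mode_prod_in_tensors:
  assumes "X \<in> tensors ns" "k < length ns" "A \<in> carrier_mat m (ns ! k)"
  shows "mode_prod X k A \<in> tensors (ns[k := m])"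
  unfolding tensors_def
proof (clarify, rule ccontr)
  fix i assume i: "i \<notin> index_box (ns[k := m])" and nz: "mode_prod X k A i \<noteq> 0"
  then have k: "k < length i" "i ! k < m" using assms by (auto simp: mode_prod_def split: if_splits)
  have "(\<Sum>l<ns ! k. A $$ (i ! k, l) * X (i[k := l])) \<noteq> 0"
    using nz k assms(3) by (simp add: mode_prod_def)
  then obtain l where l: "l < ns ! k" "X (i[k := l]) \<noteq> 0"
    using sum.neutral[of "{..<ns ! k}" "\<lambda>l. A $$ (i ! k, l) * X (i[k := l])"] by fastforce
  then have "i[k := l] \<in> index_box ns" using assms(1) by (auto simp: tensors_def)
  then have "i \<in> index_box (ns[k := m])"
    using k unfolding index_box_def by (auto simp: nth_list_update split: if_splits)
  with i show False by simp
qed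

lemma mode_prod_square_in_tensors:
  "X \<in> tensors ns \<Longrightarrow> k < length ns \<Longrightarrow> A \<in> carrier_mat (ns ! k) (ns ! k)
    \<Longrightarrow> mode_prod X k A \<in> tensors ns"
  using mode_prod_in_tensors[of X ns k A "ns ! k"] by simp

text \<open>Sizes change one mode at a time, so the intermediate results live in boxes of mixed
  size, which the induction has to carry along.\<close>

lemma partial_mode_prod_in_tensors:
  assumes X: "X \<in> tensors rs" and len: "length rs = length ns" and m: "m \<le> length ns"
    and A: "\<And>k. k < m \<Longrightarrow> As ! k \<in> carrier_mat (ns ! k) (rs ! k)"
  shows "partial_mode_prod m X As \<in> tensors (take m ns @ drop m rs)"
  using m A
proof (induction m)
  case 0
  then show ?case using X by simp
next
  case (Suc m)
  let ?s = "take m ns @ drop m rs"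
  have "mode_prod (partial_mode_prod m X As) m (As ! m) \<in> tensors (?s[m := ns ! m])"
    using Suc len by (intro mode_prod_in_tensors) (auto simp: nth_append)
  moreover have "?s[m := ns ! m] = take (Suc m) ns @ drop (Suc m) rs"
    using Suc.prems(1) len
    by (intro nth_equalityI) (auto simp: nth_append nth_list_update less_Suc_eq)
  ultimately show ?case by simp
qed

lemma partial_mode_prod_full_in_tensors:
  assumes "X \<in> tensors rs" "length rs = length ns"
    and "\<And>k. k < length ns \<Longrightarrow> As ! k \<in> carrier_mat (ns ! k) (rs ! k)"
  shows "partial_mode_prod (length ns) X As \<in> tensors ns"
  using partial_mode_prod_in_tensors[OF assms(1,2) order_refl] assms by simp

text \<open>Products in different modes commute, so only the factor in mode \<open>k\<close> itself
  can obstruct, and only if it is among the first \<open>m\<close>. The uses below have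
  \<open>k = m\<close>, where the premise is vacuous, or an identity matrix in mode
  \<open>k\<close>.\<close>

lemma partial_mode_prod_mode_prod_commute:
  assumes "k < m \<Longrightarrow> dim_col A = dim_row (As ! k) \<and> dim_row A = dim_col (As ! k) \<and> A * As ! k = As ! k * A"
  shows "partial_mode_prod m (mode_prod X k A) As = mode_prod (partial_mode_prod m X As) k A"
  using assms
proof (induction m)
  case (Suc m)
  have IH: "partial_mode_prod m (mode_prod X k A) As = mode_prod (partial_mode_prod m X As) k A"
    using Suc by auto
  show ?case
  proof (cases "k = m")
    case True
    then show ?thesis using Suc.prems IH by (simp add: mode_prod_mult)
  qed (simp add: IH mode_prod_commute)
qed simp

text \<open>The last inner factor \<open>As ! m\<close> commutes past the first \<open>m\<close>
  outer factors and then meets \<open>Bs ! m\<close> in the same mode.\<close>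

lemma partial_mode_prod_compose:
  assumes "\<And>k. k < m \<Longrightarrow> dim_col (Bs ! k) = dim_row (As ! k) \<and> Cs ! k = Bs ! k * As ! k"
  shows "partial_mode_prod m (partial_mode_prod m X As) Bs = partial_mode_prod m X Cs"
  using assms
  by (induction m) (simp_all add: partial_mode_prod_mode_prod_commute mode_prod_mult)

lemma mode_prod_partial_mode_prod:
  assumes "k < m" "m \<le> length As" "dim_col V = dim_row (As ! k)"
  shows "mode_prod (partial_mode_prod m X As) k V = partial_mode_prod m X (As[k := V * As ! k])"
  using assms
proof (induction m)
  case (Suc m)
  show ?case
  proof (cases "k = m")
    case True
    have "partial_mode_prod m X (As[m := V * As ! m]) = partial_mode_prod m X As"
      by (rule partial_mode_prod_cong) simp
    then show ?thesis using True Suc.prems by (simp add: mode_prod_mult)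
  next
    case False
    then show ?thesis using Suc by (simp add: mode_prod_commute[of m k])
  qed
qed simp

lemma partial_mode_prod_id:
  assumes "\<And>k. k < m \<Longrightarrow> mode_prod X k (As ! k) = X"
  shows "partial_mode_prod m X As = X"
  using assms by (induction m) auto

text \<open>With an identity in mode \<open>k\<close>, that mode of \<open>G\<close> keeps its size
  \<open>r\<close>. The Tucker map thereby becomes a single mode product with \<open>Us ! k\<close>,
  hence visibly linear in this factor.\<close>

definition mode_prod_except :: "tensor \<Rightarrow> real mat list \<Rightarrow> nat \<Rightarrow> nat \<Rightarrow> tensor" where
  "mode_prod_except G Us k r = partial_mode_prod (length Us) G (Us[k := 1\<^sub>m r])"

lemma mode_prod_mode_prod_except:
  assumes "k < length Us" "dim_col V = r"
  shows "mode_prod (mode_prod_except G Us k r) k V = multi_mode_prod G (Us[k := V])"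
proof -
  have "V * 1\<^sub>m r = V" using assms by auto
  with assms show ?thesis
    by (simp add: mode_prod_except_def multi_mode_prod_eq_partial mode_prod_partial_mode_prod)
qed

lemma mode_prod_except_mode_prod:
  assumes "k < length Us" "B \<in> carrier_mat r r"
  shows "mode_prod_except (mode_prod G k B) Us k r = mode_prod (mode_prod_except G Us k r) k B"
  unfolding mode_prod_except_def using assms
  by (subst partial_mode_prod_mode_prod_commute) auto

text \<open>This identifies changes of the core with those changes of the factor
  \<open>Us ! k\<close> that stay in its column space.\<close>

lemma multi_mode_prod_mode_prod:
  assumes "k < length Us" "Us ! k \<in> carrier_mat n r" "B \<in> carrier_mat r r"
  shows "multi_mode_prod (mode_prod G k B) Us = mode_prod (mode_prod_except G Us k r) k (Us ! k * B)"
proof -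
  have "multi_mode_prod (mode_prod G k B) Us = mode_prod (mode_prod_except (mode_prod G k B) Us k r) k (Us ! k)"
    using assms by (subst mode_prod_mode_prod_except) auto
  also have "\<dots> = mode_prod (mode_prod_except G Us k r) k (Us ! k * B)"
    using assms by (subst mode_prod_except_mode_prod) (auto simp: mode_prod_mult)
  finally show ?thesis .
qed

lemma mode_prod_multi_mode_prod:
  assumes "k < length Us" "Us ! k \<in> carrier_mat n r" "dim_col A = n"
  shows "mode_prod (multi_mode_prod G Us) k A = mode_prod (mode_prod_except G Us k r) k (A * Us ! k)"
  using assms
  by (simp add: multi_mode_prod_eq_partial mode_prod_partial_mode_prod mode_prod_mode_prod_except)

section \<open>Differentials of functions of tensors\<close>

text \<open>The function type carries the product topology, where convergence is convergence of each
  coordinate.\<close>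

lemma tendsto_coordinatewise:
  fixes g :: "'a \<Rightarrow> 'b \<Rightarrow> real"
  assumes "\<And>i. ((\<lambda>t. g t i) \<longlongrightarrow> l i) A"
  shows "(g \<longlongrightarrow> l) A"
proof -
  have "limitin (product_topology (\<lambda>i. euclidean) UNIV) g l A"
    unfolding limitin_componentwise using assms by simp
  then show ?thesis by (simp add: euclidean_product_topology)
qed

lemma has_real_derivative_shift_iff:
  fixes h :: "real \<Rightarrow> real"
  shows "((\<lambda>s. h (s - a)) has_real_derivative D) (at a) \<longleftrightarrow> (h has_real_derivative D) (at 0)"
  using DERIV_shift[of "\<lambda>s. h (s - a)" D 0 a] by simp

text \<open>
  The coordinates are switched on one at a time; each switch is controlled by the mean value
  theorem along a coordinate line, where only a partial derivative occurs.
\<close>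

lemma has_real_derivative_restricted_curve:
  fixes f :: "tensor \<Rightarrow> real" and F :: "nat list \<Rightarrow> tensor \<Rightarrow> real" and Z :: "real \<Rightarrow> tensor"
  assumes F: "\<And>i X. i \<in> index_box ns \<Longrightarrow> X \<in> tensors ns \<Longrightarrow>
      ((\<lambda>t. f (X(i := t))) has_real_derivative F i X) (at (X i))"
    and cont: "\<And>i. i \<in> index_box ns \<Longrightarrow> continuous_on (tensors ns) (F i)"
    and Z: "\<And>t. Z t \<in> tensors ns"
    and z: "\<And>i. i \<in> index_box ns \<Longrightarrow> ((\<lambda>t. Z t i) has_real_derivative z i) (at 0)"
    and S: "finite S" "S \<subseteq> index_box ns"
  shows "((\<lambda>t. f (\<lambda>i. if i \<in> S then Z t i else Z 0 i)) has_real_derivative (\<Sum>i\<in>S. F i (Z 0) * z i)) (at 0)"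
  using S
proof (induction S rule: finite_induct)
  case empty
  then show ?case by simp
next
  case (insert a S)
  \<comment> \<open>Only the coordinates in \<open>S\<close> have moved in \<open>Y t\<close>;
    coordinate \<open>a\<close> is to be switched next, from \<open>Z 0 a\<close> to
    \<open>Z t a\<close>.\<close>
  define Y where "Y t = (\<lambda>i. if i \<in> S then Z t i else Z 0 i)" for t
  have a: "a \<in> index_box ns" using insert by simp
  have YT: "(Y t)(a := s) \<in> tensors ns" for t s
    using Z a by (auto simp: Y_def tensors_def)
  have D: "((\<lambda>s. f ((Y t)(a := s))) has_real_derivative F a ((Y t)(a := s))) (at s)" for t s
    using F[OF a YT, of t s] by simp
  \<comment> \<open>The mean value theorem in coordinate \<open>a\<close> needs a proper interval,
    so both orders of the end points are treated; for equal end points both sides are 0.\<close>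
  have "\<exists>s. \<bar>s - Z 0 a\<bar> \<le> \<bar>Z t a - Z 0 a\<bar> \<and>
      f ((Y t)(a := Z t a)) - f ((Y t)(a := Z 0 a)) = (Z t a - Z 0 a) * F a ((Y t)(a := s))" for t
  proof (cases "Z t a" "Z 0 a" rule: linorder_cases)
    case less
    from MVT2[OF less D[of t]] obtain s where "Z t a < s" "s < Z 0 a"
      "f ((Y t)(a := Z 0 a)) - f ((Y t)(a := Z t a)) = (Z 0 a - Z t a) * F a ((Y t)(a := s))" by blast
    then show ?thesis by (intro exI[of _ s]) (auto simp: algebra_simps)
  next
    case greater
    from MVT2[OF greater D[of t]] obtain s where "Z 0 a < s" "s < Z t a"
      "f ((Y t)(a := Z t a)) - f ((Y t)(a := Z 0 a)) = (Z t a - Z 0 a) * F a ((Y t)(a := s))" by blast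
    then show ?thesis by (intro exI[of _ s]) auto
  qed auto
  then obtain \<xi> where \<xi>: "\<And>t. \<bar>\<xi> t - Z 0 a\<bar> \<le> \<bar>Z t a - Z 0 a\<bar>"
    and eq: "\<And>t. f ((Y t)(a := Z t a)) - f ((Y t)(a := Z 0 a)) = (Z t a - Z 0 a) * F a ((Y t)(a := \<xi> t))"
    by metis
  have Zlim: "((\<lambda>t. Z t i) \<longlongrightarrow> Z 0 i) (at 0)" for i
  proof (cases "i \<in> index_box ns")
    case True
    then show ?thesis using DERIV_isCont[OF z[OF True]] by (simp add: isCont_def)
  next
    case False
    then have "Z t i = 0" for t using Z by (auto simp: tensors_def)
    then show ?thesis by simp
  qed
  have "((\<lambda>t. \<bar>Z t a - Z 0 a\<bar>) \<longlongrightarrow> 0) (at 0)"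
    using Zlim[of a] by (simp add: tendsto_rabs_zero_iff LIM_zero_iff)
  then have "((\<lambda>t. \<xi> t - Z 0 a) \<longlongrightarrow> 0) (at 0)"
    by (rule Lim_null_comparison[rotated]) (use \<xi> in auto)
  then have \<xi>lim: "(\<xi> \<longlongrightarrow> Z 0 a) (at 0)" by (simp add: LIM_zero_iff)
  \<comment> \<open>The intermediate point is squeezed towards \<open>Z 0\<close>, so that
    continuity of the partial derivative \<open>F a\<close> replaces its value there by the value at
    \<open>Z 0\<close>.\<close>
  have "((\<lambda>t. (Y t)(a := \<xi> t)) \<longlongrightarrow> Z 0) (at 0)"
  proof -
    have "((\<lambda>t. ((Y t)(a := \<xi> t)) i) \<longlongrightarrow> Z 0 i) (at 0)" for i
      using \<xi>lim Zlim[of i] by (cases "i = a"; cases "i \<in> S") (auto simp: Y_def)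
    then show ?thesis by (rule tendsto_coordinatewise)
  qed
  then have Flim: "((\<lambda>t. F a ((Y t)(a := \<xi> t))) \<longlongrightarrow> F a (Z 0)) (at 0)"
    by (rule continuous_on_tendsto_compose[OF cont[OF a]]) (use Z YT in auto)
  have "((\<lambda>t. (Z t a - Z 0 a) / t) \<longlongrightarrow> z a) (at 0)"
    using z[OF a] by (simp add: has_field_derivative_iff)
  from tendsto_mult[OF Flim this]
  have "((\<lambda>t. f ((Y t)(a := Z t a)) - f ((Y t)(a := Z 0 a))) has_real_derivative F a (Z 0) * z a) (at 0)"
    by (simp add: has_field_derivative_iff eq mult.commute)
  moreover have "(Y t)(a := Z 0 a) = Y t" for t using insert.hyps by (auto simp: Y_def)
  moreover have "((\<lambda>t. f (Y t)) has_real_derivative (\<Sum>i\<in>S. F i (Z 0) * z i)) (at 0)"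
    using insert by (simp add: Y_def)
  ultimately have "((\<lambda>t. (f ((Y t)(a := Z t a)) - f (Y t)) + f (Y t)) has_real_derivative
      F a (Z 0) * z a + (\<Sum>i\<in>S. F i (Z 0) * z i)) (at 0)"
    by (intro DERIV_add) simp_all
  moreover have "(Y t)(a := Z t a) = (\<lambda>i. if i \<in> insert a S then Z t i else Z 0 i)" for t
    by (auto simp: Y_def)
  ultimately show ?case using insert.hyps by simp
qed

section \<open>The differential and the chain rule\<close>

definition tensor_differential ::
  "nat list \<Rightarrow> (nat list \<Rightarrow> tensor \<Rightarrow> real) \<Rightarrow> tensor \<Rightarrow> tensor \<Rightarrow> real" where
  "tensor_differential ns F X Z = (\<Sum>i\<in>index_box ns. F i X * Z i)"

definition C1_partials :: "nat list \<Rightarrow> (tensor \<Rightarrow> real) \<Rightarrow> (nat list \<Rightarrow> tensor \<Rightarrow> real) \<Rightarrow> bool" where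
  "C1_partials ns f F \<longleftrightarrow> (\<forall>i\<in>index_box ns. continuous_on (tensors ns) (F i) \<and>
     (\<forall>X\<in>tensors ns. ((\<lambda>t. f (X(i := t))) has_real_derivative F i X) (at (X i))))"

lemma smooth_imp_C1_partials:
  assumes "smooth_on_tensors ns f"
  obtains F where "C1_partials ns f F"
proof -
  have "Ck_on (Suc 0) ns f" using assms by (simp only: smooth_on_tensors_def)
  then have "\<forall>i\<in>index_box ns. \<exists>F'. continuous_on (tensors ns) F' \<and>
     (\<forall>X\<in>tensors ns. ((\<lambda>t. f (X(i := t))) has_real_derivative F' X) (at (X i)))"
    by auto
  then show ?thesis using that unfolding C1_partials_def by metis
qed

lemma chain_rule_tensor:
  assumes F: "C1_partials ns f F" and \<epsilon>: "\<epsilon> > 0"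
    and Z: "\<And>t. \<bar>t\<bar> < \<epsilon> \<Longrightarrow> Z t \<in> tensors ns"
    and z: "\<And>i. i \<in> index_box ns \<Longrightarrow> ((\<lambda>t. Z t i) has_real_derivative z i) (at 0)"
  shows "((\<lambda>t. f (Z t)) has_real_derivative tensor_differential ns F (Z 0) z) (at 0)"
proof -
  \<comment> \<open>The curve is known to stay in \<open>tensors ns\<close> only near 0. Cutting it
    off outside the box gives a curve that does so for all times and agrees with \<open>Z\<close>
    near 0.\<close>
  define Y where "Y t = (\<lambda>i. if i \<in> index_box ns then Z t i else 0)" for t
  have YZ: "Y t = Z t" if "\<bar>t\<bar> < \<epsilon>" for t
    using Z[OF that] by (auto simp: Y_def tensors_def)
  have YT: "Y t \<in> tensors ns" for t by (simp add: Y_def tensors_def)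
  have Yz: "((\<lambda>t. Y t i) has_real_derivative z i) (at 0)" if "i \<in> index_box ns" for i
    using z[OF that] that by (simp add: Y_def)
  have "(\<lambda>i. if i \<in> index_box ns then Y t i else Y 0 i) = Y t" for t
    by (auto simp: Y_def)
  then have "((\<lambda>t. f (Y t)) has_real_derivative (\<Sum>i\<in>index_box ns. F i (Y 0) * z i)) (at 0)"
    using has_real_derivative_restricted_curve[of ns f F Y z "index_box ns"] F YT Yz
    by (simp add: C1_partials_def finite_index_box)
  then have "((\<lambda>t. f (Y t)) has_real_derivative tensor_differential ns F (Z 0) z) (at 0)"
    using YZ[of 0] \<epsilon> by (simp add: tensor_differential_def)
  then show ?thesis
    by (rule has_field_derivative_transform_within[OF _ \<epsilon>]) (auto simp: YZ)
qed

lemma tensor_differential_lincomb: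
  "tensor_differential ns F X (\<lambda>i. a * Y i + b * Z i)
    = a * tensor_differential ns F X Y + b * tensor_differential ns F X Z"
  by (simp add: tensor_differential_def sum.distrib sum_distrib_left algebra_simps)

lemma tensor_differential_add:
  "tensor_differential ns F X (\<lambda>i. Y i + Z i)
    = tensor_differential ns F X Y + tensor_differential ns F X Z"
  using tensor_differential_lincomb[of ns F X 1 Y 1 Z] by simp

lemma tensor_differential_smult:
  "tensor_differential ns F X (\<lambda>i. c * Y i) = c * tensor_differential ns F X Y"
  using tensor_differential_lincomb[of ns F X c Y 0 Y] by simp

lemma tensor_differential_zero [simp]: "tensor_differential ns F X (\<lambda>i. 0) = 0"
  by (simp add: tensor_differential_def)

text \<open>The shift by \<open>a\<close> lets a matrix or tensor entry itself be the parameter,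
  which is the form of the partial derivatives in \<open>has_tucker_gradient\<close>.\<close>

lemma has_real_derivative_along_line:
  assumes F: "C1_partials ns f F" and X: "X \<in> tensors ns" and Z: "Z \<in> tensors ns"
  shows "((\<lambda>t. f (\<lambda>i. X i + (t - a) * Z i)) has_real_derivative tensor_differential ns F X Z) (at a)"
proof -
  have "((\<lambda>t. f (\<lambda>i. X i + t * Z i)) has_real_derivative tensor_differential ns F (\<lambda>i. X i + 0 * Z i) Z) (at 0)"
    by (rule chain_rule_tensor[OF F, of 1])
      (use X Z in \<open>auto simp: tensors_def intro!: derivative_eq_intros\<close>)
  then show ?thesis
    using has_real_derivative_shift_iff[of "\<lambda>t. f (\<lambda>i. X i + t * Z i)" a] by simp
qed

section \<open>A class of smooth functions that contains the entries of all curves to be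
  constructed\<close>

inductive elementary :: "(real \<Rightarrow> real) \<Rightarrow> bool" where
  const: "elementary (\<lambda>t. a)"
| ident: "elementary (\<lambda>t. t)"
| sin: "elementary sin"
| cos: "elementary cos"
| add: "elementary g \<Longrightarrow> elementary h \<Longrightarrow> elementary (\<lambda>t. g t + h t)"
| mult: "elementary g \<Longrightarrow> elementary h \<Longrightarrow> elementary (\<lambda>t. g t * h t)"

text \<open>Closure under differentiation is what yields derivatives of every order at once:
  iterated derivatives never leave the class.\<close>

lemma elementary_has_derivative:
  "elementary h \<Longrightarrow> \<exists>h'. elementary h' \<and> (\<forall>t. (h has_real_derivative h' t) (at t))"
proof (induction rule: elementary.induct)
  case (const a)
  show ?case by (intro exI[of _ "\<lambda>t. 0"]) (auto intro: elementary.const)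
next
  case ident
  show ?case by (intro exI[of _ "\<lambda>t. 1"]) (auto intro: elementary.const)
next
  case sin
  show ?case by (intro exI[of _ cos]) (auto intro: elementary.cos)
next
  case cos
  show ?case
    using elementary.mult[OF elementary.const[of "-1"] elementary.sin]
    by (intro exI[of _ "\<lambda>t. - sin t"]) (auto intro!: derivative_eq_intros)
next
  case (add g h)
  then obtain g' h' where "elementary g'" "\<And>t. (g has_real_derivative g' t) (at t)"
    "elementary h'" "\<And>t. (h has_real_derivative h' t) (at t)" by blast
  then show ?case
    by (intro exI[of _ "\<lambda>t. g' t + h' t"]) (auto intro!: elementary.add DERIV_add)
next
  case (mult g h)
  then obtain g' h' where "elementary g'" "\<And>t. (g has_real_derivative g' t) (at t)"
    "elementary h'" "\<And>t. (h has_real_derivative h' t) (at t)" by blast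
  with mult show ?case
    by (intro exI[of _ "\<lambda>t. g' t * h t + h' t * g t"])
      (auto intro!: elementary.add elementary.mult DERIV_mult)
qed

lemma elementary_sum:
  "(\<And>i. i \<in> S \<Longrightarrow> elementary (h i)) \<Longrightarrow> elementary (\<lambda>t. \<Sum>i\<in>S. h i t)"
  by (induction S rule: infinite_finite_induct) (auto intro: elementary.intros)

lemma elementary_diff: "elementary g \<Longrightarrow> elementary h \<Longrightarrow> elementary (\<lambda>t. g t - h t)"
  using elementary.add[OF _ elementary.mult[OF elementary.const[of "-1"]], of g h] by simp

lemma elementary_deriv: "elementary h \<Longrightarrow> elementary (deriv h)"
proof -
  assume "elementary h"
  then obtain h' where h': "elementary h'" "\<And>t. (h has_real_derivative h' t) (at t)"
    using elementary_has_derivative by blast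
  then have "deriv h = h'" by (auto intro!: DERIV_imp_deriv)
  with h' show ?thesis by simp
qed

lemma elementary_smooth:
  assumes "elementary h"
  shows "smooth_real_on S h"
  unfolding smooth_real_on_def
proof (intro allI ballI)
  fix m t
  have "elementary ((deriv ^^ m) h)" by (induction m) (auto intro: assms elementary_deriv)
  then show "(deriv ^^ m) h field_differentiable at t"
    using elementary_has_derivative by (auto simp: field_differentiable_def)
qed

section \<open>Orthogonal projections and rank\<close>

lemma mult_mat_unit_vec:
  fixes A :: "real mat"
  assumes "A \<in> carrier_mat n m" "j < m"
  shows "A *\<^sub>v unit_vec m j = col A j"
  using assms by (intro eq_vecI) auto

lemma scalar_prod_self_eq_0_iff:
  fixes v :: "real vec"
  assumes "v \<in> carrier_vec n"
  shows "v \<bullet> v = 0 \<longleftrightarrow> v = 0\<^sub>v n"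
  using assms by (auto simp: scalar_prod_def sum_nonneg_eq_0_iff intro!: eq_vecI)

lemma mat_eqI_mult_vec:
  fixes A B :: "real mat"
  assumes "A \<in> carrier_mat n m" "B \<in> carrier_mat n m"
    and "\<And>v. v \<in> carrier_vec m \<Longrightarrow> A *\<^sub>v v = B *\<^sub>v v"
  shows "A = B"
proof (rule mat_col_eqI)
  fix j assume j: "j < dim_col B"
  then have "j < m" using assms by simp
  then show "col A j = col B j"
    using assms(3)[of "unit_vec m j"] mult_mat_unit_vec[OF assms(1)] mult_mat_unit_vec[OF assms(2)] by simp
qed (use assms in auto)

text \<open>Linear independence concerns the set of columns, so either direction first has to show
  that the columns are distinct. Rank \<open>r\<close> provides \<open>r\<close> independent columns
  among a list of length \<open>r\<close>; and two equal columns \<open>i\<close>, \<open>j\<close>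
  would put the difference of the unit vectors \<open>i\<close> and \<open>j\<close> into the
  kernel.\<close>

lemma full_column_rank_iff:
  fixes A :: "real mat"
  assumes A: "A \<in> carrier_mat n r"
  shows "vec_space.rank n A = r \<longleftrightarrow> (\<forall>v\<in>carrier_vec r. A *\<^sub>v v = 0\<^sub>v n \<longrightarrow> v = 0\<^sub>v r)"
proof
  interpret vec_space "TYPE(real)" n .
  assume r: "rank A = r"
  obtain S where S: "maximal S (\<lambda>T. T \<subseteq> set (cols A) \<and> lin_indpt T)"
    using maximal_exists[of "(\<lambda>T. T \<subseteq> set (cols A) \<and> lin_indpt T)" "card (set (cols A))" "{}"]
    by (meson List.finite_set card_mono empty_iff empty_subsetI finite_lin_indpt2 rev_finite_subset)
  then have "card S = r" using rank_card_indpt[OF A S] r by simp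
  moreover have "card S \<le> card (set (cols A))" using S by (simp add: card_mono maximal_def)
  moreover have "length (cols A) = r" using A by simp
  ultimately have d: "distinct (cols A)"
    by (metis card_distinct card_length le_antisym)
  show "\<forall>v\<in>carrier_vec r. A *\<^sub>v v = 0\<^sub>v n \<longrightarrow> v = 0\<^sub>v r"
    using lin_depI[OF A _ _ _ d] full_rank_lin_indpt[OF A r d] by blast
next
  interpret vec_space "TYPE(real)" n .
  assume inj: "\<forall>v\<in>carrier_vec r. A *\<^sub>v v = 0\<^sub>v n \<longrightarrow> v = 0\<^sub>v r"
  have d: "distinct (cols A)"
    unfolding distinct_conv_nth
  proof (intro allI impI notI)
    fix i j assume ij: "i < length (cols A)" "j < length (cols A)" "i \<noteq> j" "cols A ! i = cols A ! j"
    then have ij': "i < r" "j < r" "col A i = col A j" using A by auto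
    have "A *\<^sub>v (unit_vec r i - unit_vec r j) = A *\<^sub>v unit_vec r i - A *\<^sub>v unit_vec r j"
      by (rule mult_minus_distrib_mat_vec[OF A]) auto
    also have "\<dots> = 0\<^sub>v n" using A ij' by (auto simp: mult_mat_unit_vec)
    finally have "unit_vec r i - unit_vec r j = (0\<^sub>v r :: real vec)" using inj by auto
    then have "(unit_vec r i - unit_vec r j) $ i = (0::real)" using ij' by simp
    then show False using ij' ij(3) by simp
  qed
  show "rank A = r"
    using lin_depE[OF A _ d] inj by (intro lin_indpt_full_rank[OF A d]) blast
qed

lemma left_inverse_imp_full_column_rank:
  fixes U :: "real mat"
  assumes U: "U \<in> carrier_mat n r" and W: "W \<in> carrier_mat r n" and WU: "W * U = 1\<^sub>m r"
  shows "vec_space.rank n U = r"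
  unfolding full_column_rank_iff[OF U]
proof (intro ballI impI)
  fix v :: "real vec" assume v: "v \<in> carrier_vec r" "U *\<^sub>v v = 0\<^sub>v n"
  have "v = (W * U) *\<^sub>v v" using v WU by simp
  also have "\<dots> = W *\<^sub>v (U *\<^sub>v v)" using U W v by simp
  also have "\<dots> = 0\<^sub>v r" using v W by auto
  finally show "v = 0\<^sub>v r" .
qed

lemma full_column_rank_left_cancel:
  fixes U :: "real mat"
  assumes U: "U \<in> carrier_mat n r" and rk: "vec_space.rank n U = r"
    and A: "A \<in> carrier_mat r m" "B \<in> carrier_mat r m" and eq: "U * A = U * B"
  shows "A = B"
proof (rule mat_eqI_mult_vec[OF A])
  fix v :: "real vec" assume v: "v \<in> carrier_vec m"
  have "U *\<^sub>v (A *\<^sub>v v - B *\<^sub>v v) = U *\<^sub>v (A *\<^sub>v v) - U *\<^sub>v (B *\<^sub>v v)"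
    using A v by (intro mult_minus_distrib_mat_vec[OF U]) auto
  also have "\<dots> = (U * A) *\<^sub>v v - (U * B) *\<^sub>v v" using U A v by simp
  also have "\<dots> = 0\<^sub>v n" using eq U A v by auto
  finally have z: "A *\<^sub>v v - B *\<^sub>v v = 0\<^sub>v r"
    using rk A v unfolding full_column_rank_iff[OF U] by (metis minus_carrier_vec mult_mat_vec_carrier)
  show "A *\<^sub>v v = B *\<^sub>v v"
  proof (rule eq_vecI)
    fix i assume i: "i < dim_vec (B *\<^sub>v v)"
    then have "(A *\<^sub>v v - B *\<^sub>v v) $ i = 0" using z A by auto
    then show "(A *\<^sub>v v) $ i = (B *\<^sub>v v) $ i" using i by simp
  qed (use A in auto)
qed

text \<open>A basis of the column space, chosen among the columns of \<open>P\<close>, forms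
  \<open>U\<close>; the coordinates of all columns of \<open>P\<close> in this basis form
  \<open>W\<close>. Since \<open>P\<close> is the identity on its column space,
  \<open>U W U = P U = U\<close>, and the injective \<open>U\<close> cancels.\<close>

lemma idempotent_rank_factorization:
  fixes P :: "real mat"
  assumes P: "P \<in> carrier_mat n n" and PP: "P = P * P"
  obtains U W where "U \<in> carrier_mat n (vec_space.rank n P)" "W \<in> carrier_mat (vec_space.rank n P) n"
    "U * W = P" "W * U = 1\<^sub>m (vec_space.rank n P)"
proof -
  interpret vec_space "TYPE(real)" n .
  define s where "s = rank P"
  obtain S where S: "maximal S (\<lambda>T. T \<subseteq> set (cols P) \<and> lin_indpt T)"
    using maximal_exists[of "(\<lambda>T. T \<subseteq> set (cols P) \<and> lin_indpt T)" "card (set (cols P))" "{}"]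
    by (meson List.finite_set card_mono empty_iff empty_subsetI finite_lin_indpt2 rev_finite_subset)
  have cS: "card S = s" using rank_card_indpt[OF P S] by (simp add: s_def)
  have Sc: "S \<subseteq> set (cols P)" and li: "lin_indpt S" using S by (auto simp: maximal_def)
  have cP: "set (cols P) \<subseteq> carrier_vec n" using P cols_dim by blast
  have fS: "finite S" using Sc by (meson List.finite_set finite_subset)
  obtain xs where xs: "set xs = S" "distinct xs" using finite_distinct_list[OF fS] by blast
  have ls: "length xs = s" using xs cS distinct_card by fastforce
  define U where "U = mat_of_cols n xs"
  have U: "U \<in> carrier_mat n s" by (simp add: U_def ls[symmetric])
  have cU: "cols U = xs" using xs Sc cP by (simp add: U_def cols_mat_of_cols)
  have rk: "rank U = s" using lin_indpt_full_rank[OF U] cU xs li by simp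
  \<comment> \<open>Maximality of \<open>S\<close> puts every column of \<open>P\<close> into its
    span.\<close>
  have "\<exists>w\<in>carrier_vec s. U *\<^sub>v w = col P j" if j: "j < n" for j
  proof -
    have cj: "col P j \<in> set (cols P)" using j P by (metis carrier_matD(2) cols_length cols_nth nth_mem)
    have "col P j \<in> span S"
    proof (cases "col P j \<in> S")
      case True
      then show ?thesis using span_mem[of S] Sc cP by auto
    next
      case False
      have "lin_dep (S \<union> {col P j})"
        using S False Sc cj unfolding maximal_def by blast
      then show ?thesis
        using lin_dep_iff_in_span[of S "col P j"] Sc cP li cj False by auto
    qed
    then obtain a where a: "lincomb a S = col P j"
      using finite_in_span[OF fS] Sc cP by blast
    have "U *\<^sub>v vec s (\<lambda>i. a (col U i)) = col P j"
      using mat_mult_eq_lincomb[OF U, of a] cU xs a by simp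
    then show ?thesis by (intro bexI[of _ "vec s (\<lambda>i. a (col U i))"]) auto
  qed
  then obtain w where w: "\<And>j. j < n \<Longrightarrow> w j \<in> carrier_vec s" "\<And>j. j < n \<Longrightarrow> U *\<^sub>v w j = col P j"
    by metis
  define W where "W = mat_of_cols s (map w [0..<n])"
  have W: "W \<in> carrier_mat s n" using mat_of_cols_carrier(1)[of s "map w [0..<n]"] by (simp add: W_def)
  have UW: "U * W = P"
  proof (rule mat_col_eqI)
    fix j assume "j < dim_col P"
    then have j: "j < n" using P by simp
    have "col W j = w j" using w j by (simp add: W_def)
    then show "col (U * W) j = col P j" using w j col_mult2[OF U W j] by simp
  qed (use U W P in auto)
  \<comment> \<open>Idempotence says that \<open>P\<close> fixes each of its own columns, and the
    columns of \<open>U\<close> are among them.\<close>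
  have PU: "P * U = U"
  proof (rule mat_col_eqI)
    fix j assume "j < dim_col U"
    then have j: "j < s" using U by simp
    then have "col U j \<in> set (cols P)" using xs ls Sc U cU by (metis carrier_matD(2) cols_nth nth_mem subsetD)
    then obtain i where i: "i < n" "col U j = col P i"
      using P by (metis carrier_matD(2) cols_length cols_nth in_set_conv_nth)
    have "col (P * U) j = P *\<^sub>v col P i" using col_mult2[OF P U j] i by simp
    also have "\<dots> = col (P * P) i" using col_mult2[OF P P i(1)] by simp
    finally show "col (P * U) j = col U j" using PP i by simp
  qed (use U P in auto)
  have "U * (W * U) = U * 1\<^sub>m s"
    using PU UW assoc_mult_mat[OF U W U] U by simp
  then have "W * U = 1\<^sub>m s"
    by (rule full_column_rank_left_cancel[OF U rk mult_carrier_mat[OF W U] one_carrier_mat])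
  with U W UW show ?thesis using that by (simp add: s_def)
qed

section \<open>Ranks of idempotents by way of the trace\<close>

definition trace_mat :: "real mat \<Rightarrow> real" where
  "trace_mat A = (\<Sum>i<dim_row A. A $$ (i, i))"

lemma trace_mat_commute:
  assumes "A \<in> carrier_mat n m" "B \<in> carrier_mat m n"
  shows "trace_mat (A * B) = trace_mat (B * A)"
  using assms
  by (simp add: trace_mat_def scalar_prod_def, subst sum.swap)
    (simp add: mult.commute atLeast0LessThan)

text \<open>In the factorization \<open>P = U W\<close> with \<open>W U\<close> an identity, the
  trace of \<open>U W\<close> is that of \<open>W U\<close>, which is its size.\<close>

lemma rank_idempotent_eq_trace:
  fixes P :: "real mat"
  assumes P: "P \<in> carrier_mat n n" and PP: "P = P * P"
  shows "real (vec_space.rank n P) = trace_mat P"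
proof -
  obtain U W where "U \<in> carrier_mat n (vec_space.rank n P)" "W \<in> carrier_mat (vec_space.rank n P) n"
    "U * W = P" "W * U = 1\<^sub>m (vec_space.rank n P)"
    using idempotent_rank_factorization[OF assms] .
  then show ?thesis using trace_mat_commute[of U n _ W] by (simp add: trace_mat_def)
qed

lemma one_minus_idempotent:
  fixes P :: "real mat"
  assumes P: "P \<in> carrier_mat n n" and PP: "P = P * P"
  shows "1\<^sub>m n - P = (1\<^sub>m n - P) * (1\<^sub>m n - P)"
proof -
  have "(1\<^sub>m n - P) * (1\<^sub>m n - P) = (1\<^sub>m n - P) * 1\<^sub>m n - (1\<^sub>m n - P) * P"
    using P by (intro mult_minus_distrib_mat) auto
  also have "(1\<^sub>m n - P) * P = 1\<^sub>m n * P - P * P"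
    using P by (intro minus_mult_distrib_mat) auto
  also have "\<dots> = 0\<^sub>m n n" using P PP by auto
  finally show ?thesis using P by (auto intro!: eq_matI)
qed

text \<open>The trace is additive, so ranks of complementary idempotents add up to \<open>n\<close>;
  the bound on the rank of \<open>P\<close> makes the subtraction of naturals exact.\<close>

lemma rank_one_minus_idempotent:
  fixes P :: "real mat"
  assumes P: "P \<in> carrier_mat n n" and PP: "P = P * P"
  shows "vec_space.rank n (1\<^sub>m n - P) = n - vec_space.rank n P"
proof -
  have "trace_mat (1\<^sub>m n - P) = real n - trace_mat P"
    using P by (simp add: trace_mat_def sum_subtractf)
  moreover have "vec_space.rank n P \<le> n" using vec_space.rank_le_nc[OF P] .
  ultimately show ?thesis
    using rank_idempotent_eq_trace[OF assms]
      rank_idempotent_eq_trace[OF minus_carrier_mat[OF P] one_minus_idempotent[OF assms]]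
    by simp
qed

text \<open>\<open>U * W\<close> is then the orthogonal projection onto the column space of \<open>U\<close>.\<close>

definition projection_factors :: "nat \<Rightarrow> nat \<Rightarrow> real mat \<Rightarrow> real mat \<Rightarrow> bool" where
  "projection_factors n r U W \<longleftrightarrow> U \<in> carrier_mat n r \<and> W \<in> carrier_mat r n \<and>
     W * U = 1\<^sub>m r \<and> transpose_mat (U * W) = U * W"

lemma projection_factors_mult:
  assumes "projection_factors n r U W"
  shows "(U * W) * U = U" "(1\<^sub>m n - U * W) * U = 0\<^sub>m n r" "U * W = (U * W) * (U * W)"
proof -
  have U: "U \<in> carrier_mat n r" and W: "W \<in> carrier_mat r n" and WU: "W * U = 1\<^sub>m r"
    using assms by (auto simp: projection_factors_def)
  show *: "(U * W) * U = U" using U W WU by (simp add: assoc_mult_mat[of _ n r _ n])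
  have "(1\<^sub>m n - U * W) * U = 1\<^sub>m n * U - (U * W) * U"
    using U W by (intro minus_mult_distrib_mat) auto
  then show "(1\<^sub>m n - U * W) * U = 0\<^sub>m n r" using * U by auto
  have "(U * W) * (U * W) = (U * W) * U * W"
    using assoc_mult_mat[OF mult_carrier_mat[OF U W] U W] by simp
  then show "U * W = (U * W) * (U * W)" using * by simp
qed

text \<open>The trace of \<open>U W\<close> equals that of \<open>W U\<close>, the identity of size
  \<open>r\<close>, so the complement has rank \<open>n - r\<close>.\<close>

lemma projection_factors_Gr:
  assumes pf: "projection_factors n r U W"
  shows "1\<^sub>m n - U * W \<in> Gr (n - r) n"
proof -
  let ?Q = "U * W"
  have U: "U \<in> carrier_mat n r" and W: "W \<in> carrier_mat r n" and WU: "W * U = 1\<^sub>m r"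
    and sym: "transpose_mat ?Q = ?Q"
    using pf by (auto simp: projection_factors_def)
  have Q: "?Q \<in> carrier_mat n n" using U W by simp
  have QQ: "?Q = ?Q * ?Q" using projection_factors_mult[OF pf] by simp
  have "real (vec_space.rank n ?Q) = real r"
    using rank_idempotent_eq_trace[OF Q QQ] trace_mat_commute[OF U W] WU by (simp add: trace_mat_def)
  then have "vec_space.rank n (1\<^sub>m n - ?Q) = n - r"
    using rank_one_minus_idempotent[OF Q QQ] by simp
  moreover have "transpose_mat (1\<^sub>m n - ?Q) = 1\<^sub>m n - ?Q"
    using transpose_minus[OF one_carrier_mat Q] sym by simp
  ultimately show ?thesis
    using one_minus_idempotent[OF Q QQ] Q minus_carrier_mat[OF Q] by (simp add: Gr_def)
qed

lemma Gr_projection_factors: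
  assumes P: "P \<in> Gr (n - r) n" and r: "r \<le> n"
  obtains U W where "projection_factors n r U W" "P = 1\<^sub>m n - U * W"
proof -
  have PC: "P \<in> carrier_mat n n" and sym: "transpose_mat P = P" and rk: "vec_space.rank n P = n - r"
    and PP: "P = P * P" using P by (auto simp: Gr_def)
  let ?Q = "1\<^sub>m n - P"
  \<comment> \<open>Here \<open>r \<le> n\<close> enters: it turns \<open>n - (n - r)\<close> back
    into \<open>r\<close>.\<close>
  have "vec_space.rank n ?Q = r" using rank_one_minus_idempotent[OF PC PP] rk r by simp
  moreover have Q: "?Q \<in> carrier_mat n n" using PC by (rule minus_carrier_mat)
  ultimately obtain U W where UW: "U \<in> carrier_mat n r" "W \<in> carrier_mat r n" "U * W = ?Q" "W * U = 1\<^sub>m r"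
    using idempotent_rank_factorization[OF Q one_minus_idempotent[OF PC PP]] by metis
  have "transpose_mat ?Q = ?Q" using transpose_minus[OF one_carrier_mat PC] sym by simp
  with UW have "projection_factors n r U W" by (simp add: projection_factors_def)
  moreover have "P = 1\<^sub>m n - U * W" using UW PC by (auto intro!: eq_matI)
  ultimately show ?thesis using that by blast
qed

text \<open>The witness is the pseudoinverse \<open>N U^T\<close>, with \<open>N\<close> the inverse
  of the Gram matrix \<open>U^T U\<close>. That matrix is invertible because a kernel vector
  \<open>v\<close> satisfies \<open>(U v) \<bullet> (U v) = v \<bullet> (U^T U v) = 0\<close>, and
  \<open>U\<close> is injective.\<close>

lemma full_column_rank_projection_factors:
  fixes U :: "real mat"
  assumes U: "U \<in> carrier_mat n r" and rk: "vec_space.rank n U = r"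
  obtains W where "projection_factors n r U W"
proof -
  let ?T = "transpose_mat U"
  let ?M = "?T * U"
  have M: "?M \<in> carrier_mat r r" using U by simp
  have "det ?M \<noteq> 0"
  proof
    assume "det ?M = 0"
    then obtain v where v: "v \<in> carrier_vec r" "v \<noteq> 0\<^sub>v r" "?M *\<^sub>v v = 0\<^sub>v r"
      using det_0_iff_vec_prod_zero_field[OF M] by blast
    have Uv: "U *\<^sub>v v \<in> carrier_vec n" using U v by simp
    have "(U *\<^sub>v v) \<bullet> (U *\<^sub>v v) = v \<bullet> (?T *\<^sub>v (U *\<^sub>v v))"
      using U v Uv transpose_vec_mult_scalar[OF U v(1) Uv] comm_scalar_prod[OF Uv Uv]
      by (metis comm_scalar_prod mult_mat_vec_carrier transpose_carrier_mat)
    also have "\<dots> = 0" using v U by simp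
    finally have "U *\<^sub>v v = 0\<^sub>v n" using Uv by (simp add: scalar_prod_self_eq_0_iff)
    then show False using rk v unfolding full_column_rank_iff[OF U] by blast
  qed
  from det_non_zero_imp_unit[OF M this] obtain N where
    N: "N \<in> carrier_mat r r" "N * ?M = 1\<^sub>m r" "?M * N = 1\<^sub>m r"
    by (auto simp: Units_def ring_mat_def)
  \<comment> \<open>The inverse of a symmetric matrix is symmetric, and therefore so is
    \<open>U N U^T\<close>.\<close>
  have tN: "transpose_mat N = N"
  proof -
    have "transpose_mat ?M = ?M" using U by (simp add: transpose_mult[of _ r n])
    then have "transpose_mat N * ?M = 1\<^sub>m r"
      using transpose_mult[OF M N(1)] N by simp
    then have "transpose_mat N * (?M * N) = N"
      using N M by (metis assoc_mult_mat left_mult_one_mat transpose_carrier_mat)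
    then show ?thesis using N by simp
  qed
  let ?W = "N * ?T"
  have "?W * U = 1\<^sub>m r" using N U by (simp add: assoc_mult_mat[of _ r r _ n])
  moreover have "transpose_mat (U * ?W) = U * ?W"
    using N U tN by (simp add: transpose_mult[of _ n r _ n] transpose_mult[of _ r r _ n] assoc_mult_mat[of _ n r _ r])
  ultimately have "projection_factors n r U ?W" using U N by (simp add: projection_factors_def)
  then show ?thesis using that by blast
qed

lemma inv_mat:
  assumes "R \<in> GL r"
  shows "inv_mat R \<in> carrier_mat r r" "inv_mat R * R = 1\<^sub>m r" "R * inv_mat R = 1\<^sub>m r"
proof -
  have R: "R \<in> carrier_mat r r" and inv: "invertible_mat R" using assms by (auto simp: GL_def)
  then obtain B where B: "R * B = 1\<^sub>m r" "B * R = 1\<^sub>m (dim_row B)"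
    by (auto simp: invertible_mat_def inverts_mat_def)
  then have BC: "B \<in> carrier_mat r r"
    using R by (metis carrier_matD(2) carrier_matI index_mult_mat(3) index_one_mat(3))
  have "R \<in> Units (ring_mat TYPE(real) r ())"
    using R B BC by (auto simp: Units_def ring_mat_def)
  then obtain C where "mat_inverse R = Some C" using mat_inverse(1)[OF R] by fastforce
  then show "inv_mat R \<in> carrier_mat r r" "inv_mat R * R = 1\<^sub>m r" "R * inv_mat R = 1\<^sub>m r"
    using mat_inverse(2)[OF R] by (auto simp: inv_mat_def)
qed

text \<open>The product \<open>U (R (U R)^T)\<close> is \<open>(U R) (U R)^T\<close>, the projection
  that belongs to the orthonormalized factor \<open>U R\<close>. Thus \<open>U\<close> can be kept
  as factor without changing the point of the manifold.\<close>

lemma orthonormalized_projection_factors: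
  assumes U: "U \<in> carrier_mat n r" and R: "R \<in> GL r" and UR: "U * R \<in> St r n"
  shows "projection_factors n r U (R * transpose_mat (U * R))"
proof -
  let ?T = "transpose_mat (U * R)"
  have RC: "R \<in> carrier_mat r r" using R by (simp add: GL_def)
  have T: "?T \<in> carrier_mat r n" using U RC by simp
  have "?T * (U * R) = 1\<^sub>m r" using UR by (simp add: St_def)
  then have "(?T * U) * R = 1\<^sub>m r" using U RC T by (metis assoc_mult_mat)
  \<comment> \<open>For square matrices a one-sided inverse is two-sided.\<close>
  then have "R * (?T * U) = 1\<^sub>m r"
    using mat_mult_left_right_inverse[of "?T * U" r R] mult_carrier_mat[OF T U] RC by blast
  then have "(R * ?T) * U = 1\<^sub>m r" using U RC T by (metis assoc_mult_mat)
  moreover have "U * (R * ?T) = (U * R) * ?T" using assoc_mult_mat[OF U RC T] by simp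
  moreover have "transpose_mat ((U * R) * ?T) = (U * R) * ?T"
    using U RC T by (simp add: transpose_mult[of "U * R" n r ?T n])
  ultimately show ?thesis using U RC T by (simp add: projection_factors_def)
qed

section \<open>Rotating a projection\<close>

text \<open>This reduces the inner product of two columns of a plane rotation to the inner products
  among \<open>p\<close>, \<open>w\<close> and the unit vectors.\<close>

lemma sum_product_expand:
  fixes d e p w :: "'a \<Rightarrow> real"
  shows "(\<Sum>l\<in>S. (d l + p l * a + w l * b) * (e l + p l * a' + w l * b')) =
    (\<Sum>l\<in>S. d l * e l) + a' * (\<Sum>l\<in>S. d l * p l) + b' * (\<Sum>l\<in>S. d l * w l)
    + a * (\<Sum>l\<in>S. e l * p l) + b * (\<Sum>l\<in>S. e l * w l)
    + a * a' * (\<Sum>l\<in>S. p l * p l) + (a * b' + b * a') * (\<Sum>l\<in>S. p l * w l)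
    + b * b' * (\<Sum>l\<in>S. w l * w l)"
  by (simp add: sum.distrib sum_distrib_left algebra_simps)

text \<open>Rotation by the angle \<open>t\<close> in the plane spanned by the orthonormal vectors \<open>p\<close> and \<open>w\<close>.\<close>

definition plane_rotation :: "nat \<Rightarrow> (nat \<Rightarrow> real) \<Rightarrow> (nat \<Rightarrow> real) \<Rightarrow> real \<Rightarrow> real mat" where
  "plane_rotation n p w t = Matrix.mat n n (\<lambda>(i, j). (if i = j then 1 else 0)
     + sin t * (p i * w j - w i * p j) - (1 - cos t) * (p i * p j + w i * w j))"

lemma plane_rotation_carrier [simp]:
  "plane_rotation n p w t \<in> carrier_mat n n"
  "dim_row (plane_rotation n p w t) = n" "dim_col (plane_rotation n p w t) = n"
  by (simp_all add: plane_rotation_def)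

lemma plane_rotation_orthogonal:
  assumes pp: "(\<Sum>l<n. p l * p l) = 1" and pw: "(\<Sum>l<n. p l * w l) = 0" and ww: "(\<Sum>l<n. w l * w l) = 1"
  shows "transpose_mat (plane_rotation n p w t) * plane_rotation n p w t = 1\<^sub>m n"
proof (rule eq_matI)
  fix i j assume "i < dim_row (1\<^sub>m n :: real mat)" "j < dim_col (1\<^sub>m n :: real mat)"
  then have i: "i < n" and j: "j < n" by auto
  \<comment> \<open>Column \<open>m\<close> of the rotation is the unit vector \<open>m\<close> plus
    \<open>A m\<close> times \<open>p\<close> plus \<open>B m\<close> times
    \<open>w\<close>.\<close>
  define A B where "A m = sin t * w m - (1 - cos t) * p m"
    and "B m = - sin t * p m - (1 - cos t) * w m" for m
  let ?d = "\<lambda>m l. if l = m then 1 else (0::real)"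
  have entry: "plane_rotation n p w t $$ (l, m) = ?d m l + p l * A m + w l * B m"
    if "l < n" "m < n" for l m
    using that by (simp add: plane_rotation_def A_def B_def algebra_simps)
  have "(transpose_mat (plane_rotation n p w t) * plane_rotation n p w t) $$ (i, j)
      = (\<Sum>l<n. (?d i l + p l * A i + w l * B i) * (?d j l + p l * A j + w l * B j))"
    using i j by (simp add: scalar_prod_def entry atLeast0LessThan)
  also have "\<dots> = ?d j i + A j * p i + B j * w i + A i * p j + B i * w j + A i * A j + B i * B j"
    unfolding sum_product_expand pp pw ww using i j by (simp add: mult_delta_left)
  also have "\<dots> = ?d j i + (p i * p j + w i * w j) * ((sin t)\<^sup>2 + (1 - cos t)\<^sup>2 - 2 * (1 - cos t))"
  proof -
    have "(s * wj - k * pj) * pi' + (- s * pj - k * wj) * wi + (s * wi - k * pi') * pj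
        + (- s * pi' - k * wi) * wj + (s * wi - k * pi') * (s * wj - k * pj)
        + (- s * pi' - k * wi) * (- s * pj - k * wj)
        = (pi' * pj + wi * wj) * (s\<^sup>2 + k\<^sup>2 - 2 * k)" for s k pi' pj wi wj :: real
      by (simp add: power2_eq_square algebra_simps)
    from this[of "sin t" "w j" "1 - cos t" "p j" "p i" "w i"] show ?thesis
      unfolding A_def B_def by linarith
  qed
  \<comment> \<open>With \<open>s = sin t\<close> and \<open>k = 1 - cos t\<close>, the Pythagorean
    identity reads \<open>s^2 + k^2 = 2 k\<close>, which removes everything but the identity
    matrix.\<close>
  also have "(sin t)\<^sup>2 + (1 - cos t)\<^sup>2 - 2 * (1 - cos t) = 0"
    using sin_cos_squared_add[of t] by (simp add: power2_eq_square algebra_simps)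
  finally show "(transpose_mat (plane_rotation n p w t) * plane_rotation n p w t) $$ (i, j) = 1\<^sub>m n $$ (i, j)"
    using i j by simp
qed (simp_all add: plane_rotation_def)

text \<open>An orthogonal \<open>R\<close> conjugates the projection \<open>Q = U W\<close> into
  \<open>R Q R^T\<close>, which is again symmetric, and cancels in the product of the new factors in
  the other order.\<close>

lemma projection_factors_orthogonal:
  assumes pf: "projection_factors n r U W" and R: "R \<in> carrier_mat n n"
    and RR: "transpose_mat R * R = 1\<^sub>m n"
  shows "projection_factors n r (R * U) (W * transpose_mat R)"
proof -
  let ?T = "transpose_mat R"
  have U: "U \<in> carrier_mat n r" and W: "W \<in> carrier_mat r n" and WU: "W * U = 1\<^sub>m r"
    and sym: "transpose_mat (U * W) = U * W" using pf by (auto simp: projection_factors_def)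
  have T: "?T \<in> carrier_mat n n" using R by simp
  have "(W * ?T) * (R * U) = W * (?T * (R * U))"
    by (rule assoc_mult_mat[OF W T mult_carrier_mat[OF R U]])
  also have "?T * (R * U) = U" using assoc_mult_mat[OF T R U] RR U by simp
  finally have 1: "(W * ?T) * (R * U) = 1\<^sub>m r" using WU by simp
  have eq: "(R * U) * (W * ?T) = R * (U * W) * ?T"
    using assoc_mult_mat[OF mult_carrier_mat[OF R U] W T] assoc_mult_mat[OF R U W] by simp
  have RQ: "R * (U * W) \<in> carrier_mat n n" using R U W by simp
  have "transpose_mat (R * (U * W) * ?T) = R * transpose_mat (R * (U * W))"
    using transpose_mult[OF RQ T] by simp
  also have "\<dots> = R * ((U * W) * ?T)"
    using transpose_mult[OF R mult_carrier_mat[OF U W]] sym by simp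
  also have "\<dots> = R * (U * W) * ?T"
    using assoc_mult_mat[OF R mult_carrier_mat[OF U W] T] by simp
  finally show ?thesis
    using 1 eq U W R T by (simp add: projection_factors_def)
qed

section \<open>Matrix units and a curve of projections\<close>

definition mat_unit :: "nat \<Rightarrow> nat \<Rightarrow> nat \<Rightarrow> nat \<Rightarrow> real mat" where
  "mat_unit m n a b = Matrix.mat m n (\<lambda>ij. if ij = (a, b) then 1 else 0)"

lemma mat_unit_carrier [simp]: "mat_unit m n a b \<in> carrier_mat m n"
  by (simp add: mat_unit_def)

lemma mult_mat_unit_index:
  assumes "A \<in> carrier_mat l m" "i < l" "j < n" "a < m"
  shows "(A * mat_unit m n a b) $$ (i, j) = (if j = b then A $$ (i, a) else 0)"
proof -
  have "(A * mat_unit m n a b) $$ (i, j) = (\<Sum>k<m. A $$ (i, k) * (if k = a \<and> j = b then 1 else 0))"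
    using assms by (simp add: scalar_prod_def mat_unit_def atLeast0LessThan)
  also have "\<dots> = (\<Sum>k<m. if k = a then (if j = b then A $$ (i, k) else 0) else 0)"
    by (intro sum.cong) auto
  finally show ?thesis using assms by simp
qed

lemma mult_entry:
  assumes "A \<in> carrier_mat l m" "B \<in> carrier_mat m n" "i < l" "j < n"
  shows "(A * B) $$ (i, j) = (\<Sum>k<m. A $$ (i, k) * B $$ (k, j))"
  using assms by (simp add: scalar_prod_def atLeast0LessThan)

text \<open>
  The direction \<open>(I - U W) E\<close>, with \<open>E\<close> a matrix unit, is up to scale the initial velocity of
  the curve obtained by rotating \<open>U\<close> in the plane of a column of \<open>I - U W\<close> and a row of \<open>W\<close>.
\<close>

lemma projection_factors_curve:
  assumes pf: "projection_factors n r U W" and a: "a < n" and b: "b < r"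
  obtains V Y \<sigma> where "\<sigma> \<noteq> 0" "V 0 = U" "Y 0 = W" "\<And>t. projection_factors n r (V t) (Y t)"
    "\<And>i j. i < n \<Longrightarrow> j < r \<Longrightarrow> elementary (\<lambda>t. V t $$ (i, j))"
    "\<And>i j. i < n \<Longrightarrow> j < n \<Longrightarrow> elementary (\<lambda>t. (V t * Y t) $$ (i, j))"
    "\<And>i j. i < n \<Longrightarrow> j < r \<Longrightarrow> ((\<lambda>t. V t $$ (i, j)) has_real_derivative
        \<sigma> * ((1\<^sub>m n - U * W) * mat_unit n r a b) $$ (i, j)) (at 0)"
proof -
  let ?P = "1\<^sub>m n - U * W"
  have U: "U \<in> carrier_mat n r" and W: "W \<in> carrier_mat r n" and WU: "W * U = 1\<^sub>m r"
    and sym: "transpose_mat (U * W) = U * W" using pf by (auto simp: projection_factors_def)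
  have Q: "U * W \<in> carrier_mat n n" using U W by simp
  have P: "?P \<in> carrier_mat n n" using Q by (rule minus_carrier_mat)
  \<comment> \<open>With \<open>p\<close> the column \<open>a\<close> of \<open>?P\<close> and
    \<open>w\<close> the row \<open>b\<close> of \<open>W\<close>, the required direction has
    \<open>p\<close> as its column \<open>b\<close> and zeros elsewhere, and \<open>w\<close> has
    inner product 1 with column \<open>b\<close> of \<open>U\<close> and 0 with the others.\<close>
  define p where "p i = ?P $$ (i, a)" for i
  define w where "w j = W $$ (b, j)" for j
  have dir: "(?P * mat_unit n r a b) $$ (i, j) = (if j = b then p i else 0)" if "i < n" "j < r" for i j
    using mult_mat_unit_index[OF P that a] by (simp add: p_def)
  show ?thesis
  proof (cases "\<forall>i<n. p i = 0")
    case True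
    \<comment> \<open>A zero direction is realized by the constant curve; any nonzero factor will
      do.\<close>
    show ?thesis
      by (rule that[of 1 "\<lambda>t. U" "\<lambda>t. W"]) (simp_all add: pf elementary.const dir True)
  next
    case False
    define \<alpha> where "\<alpha> = sqrt (\<Sum>l<n. p l * p l)"
    define \<beta> where "\<beta> = sqrt (\<Sum>l<n. w l * w l)"
    have wU: "(\<Sum>l<n. w l * U $$ (l, j)) = (if j = b then 1 else 0)" if j: "j < r" for j
    proof -
      have "(\<Sum>l<n. w l * U $$ (l, j)) = (W * U) $$ (b, j)"
        using mult_entry[OF W U b j] by (simp add: w_def)
      then show ?thesis using WU b j by auto
    qed
    \<comment> \<open>Symmetry turns the column \<open>a\<close> of \<open>?P\<close> into its row
      \<open>a\<close>, and \<open>?P\<close> annihilates \<open>U\<close>.\<close>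
    have pU: "(\<Sum>l<n. p l * U $$ (l, j)) = 0" if j: "j < r" for j
    proof -
      have Psym: "?P $$ (l, a) = ?P $$ (a, l)" if "l < n" for l
        using arg_cong[OF sym, of "\<lambda>M. M $$ (a, l)"] that a U W by auto
      have "(\<Sum>l<n. p l * U $$ (l, j)) = (?P * U) $$ (a, j)"
        using mult_entry[OF P U a j] Psym by (simp add: p_def)
      then show ?thesis using projection_factors_mult(2)[OF pf] a j by simp
    qed
    have WP: "W * ?P = 0\<^sub>m r n"
    proof -
      have "W * ?P = W * 1\<^sub>m n - W * (U * W)" by (rule mult_minus_distrib_mat[OF W one_carrier_mat Q])
      also have "W * (U * W) = W" using assoc_mult_mat[OF W U W] WU W by simp
      finally show ?thesis using W by simp
    qed
    have pw: "(\<Sum>l<n. p l * w l) = 0"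
      using mult_entry[OF W P b a] WP a b by (simp add: p_def w_def mult.commute)
    obtain i0 where "i0 < n" "p i0 \<noteq> 0" using False by blast
    then have "(\<Sum>l<n. p l * p l) \<noteq> 0" by (auto simp: sum_nonneg_eq_0_iff)
    then have \<alpha>: "\<alpha> \<noteq> 0" "\<alpha> * \<alpha> = (\<Sum>l<n. p l * p l)" by (auto simp: \<alpha>_def sum_nonneg)
    \<comment> \<open>\<open>w\<close> cannot vanish because its inner product with column
      \<open>b\<close> of \<open>U\<close> is 1.\<close>
    have "(\<Sum>l<n. w l * w l) \<noteq> 0"
    proof
      assume "(\<Sum>l<n. w l * w l) = 0"
      then have "\<forall>l<n. w l = 0" by (simp add: sum_nonneg_eq_0_iff)
      then show False using wU[OF b] by simp
    qed
    then have \<beta>: "\<beta> \<noteq> 0" "\<beta> * \<beta> = (\<Sum>l<n. w l * w l)" by (auto simp: \<beta>_def sum_nonneg)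
    define p' where "p' i = p i / \<alpha>" for i
    define w' where "w' i = w i / \<beta>" for i
    have "(\<Sum>l<n. p' l * p' l) = (\<Sum>l<n. p l * p l) / (\<alpha> * \<alpha>)"
      by (simp add: p'_def sum_divide_distrib)
    then have on1: "(\<Sum>l<n. p' l * p' l) = 1" unfolding \<alpha>(2)[symmetric] using \<alpha>(1) by simp
    have "(\<Sum>l<n. w' l * w' l) = (\<Sum>l<n. w l * w l) / (\<beta> * \<beta>)"
      by (simp add: w'_def sum_divide_distrib)
    then have on2: "(\<Sum>l<n. w' l * w' l) = 1" unfolding \<beta>(2)[symmetric] using \<beta>(1) by simp
    have "(\<Sum>l<n. p' l * w' l) = (\<Sum>l<n. p l * w l) / (\<alpha> * \<beta>)"
      by (simp add: p'_def w'_def sum_divide_distrib)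
    then have on3: "(\<Sum>l<n. p' l * w' l) = 0" using pw by simp
    define R where "R = plane_rotation n p' w'"
    have R: "R t \<in> carrier_mat n n" for t by (simp add: R_def)
    have Rent: "R t $$ (i, j) = (if i = j then 1 else 0) + sin t * (p' i * w' j - w' i * p' j)
        - (1 - cos t) * (p' i * p' j + w' i * w' j)" if "i < n" "j < n" for i j t
      using that by (simp add: R_def plane_rotation_def)
    have R0: "R 0 = 1\<^sub>m n" by (rule eq_matI) (auto simp: R_def plane_rotation_def)
    have Rel: "elementary (\<lambda>t. R t $$ (i, j))" if "i < n" "j < n" for i j
      unfolding Rent[OF that]
      by (intro elementary.add elementary_diff elementary.mult elementary.const elementary.sin elementary.cos)
    define V where "V t = R t * U" for t
    define Y where "Y t = W * transpose_mat (R t)" for t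
    have V: "V t \<in> carrier_mat n r" and Y: "Y t \<in> carrier_mat r n" for t
      unfolding V_def Y_def using R W by (auto intro!: mult_carrier_mat[OF R U] mult_carrier_mat[OF W])
    have Vel: "elementary (\<lambda>t. V t $$ (i, j))" if "i < n" "j < r" for i j
      unfolding V_def mult_entry[OF R U that]
      using that by (intro elementary_sum elementary.mult elementary.const Rel) auto
    have Yel: "elementary (\<lambda>t. Y t $$ (i, j))" if "i < r" "j < n" for i j
    proof -
      have "(\<lambda>t. Y t $$ (i, j)) = (\<lambda>t. \<Sum>l<n. W $$ (i, l) * R t $$ (j, l))"
        unfolding Y_def using R that
        by (subst mult_entry[OF W, of _ n]) (auto simp: fun_eq_iff carrier_matD[OF R])
      moreover have "elementary (\<lambda>t. \<Sum>l<n. W $$ (i, l) * R t $$ (j, l))"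
        using that by (intro elementary_sum elementary.mult elementary.const Rel) auto
      ultimately show ?thesis by simp
    qed
    have VYel: "elementary (\<lambda>t. (V t * Y t) $$ (i, j))" if "i < n" "j < n" for i j
      unfolding mult_entry[OF V Y that]
      using that by (intro elementary_sum elementary.mult Vel Yel) auto
    have der: "((\<lambda>t. V t $$ (i, j)) has_real_derivative
        1 / (\<alpha> * \<beta>) * (?P * mat_unit n r a b) $$ (i, j)) (at 0)" if ij: "i < n" "j < r" for i j
    proof -
      have "((\<lambda>t. \<Sum>l<n. R t $$ (i, l) * U $$ (l, j)) has_real_derivative
          (\<Sum>l<n. (p' i * w' l - w' i * p' l) * U $$ (l, j))) (at 0)"
      proof (rule DERIV_sum)
        fix l assume "l \<in> {..<n}"
        then have l: "l < n" by simp
        show "((\<lambda>t. R t $$ (i, l) * U $$ (l, j)) has_real_derivative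
            (p' i * w' l - w' i * p' l) * U $$ (l, j)) (at 0)"
          unfolding Rent[OF ij(1) l] by (auto intro!: derivative_eq_intros)
      qed
      \<comment> \<open>The initial velocity of the rotation is \<open>p' w'^T - w' p'^T\<close>.
        Applied to \<open>U\<close>, its second part vanishes and the first leaves \<open>p\<close>
        in column \<open>b\<close>; normalizing \<open>p\<close> and \<open>w\<close> accounts for
        the factor \<open>1 / (\<alpha> * \<beta>)\<close>.\<close>
      moreover have "(\<Sum>l<n. (p' i * w' l - w' i * p' l) * U $$ (l, j))
          = p i / (\<alpha> * \<beta>) * (\<Sum>l<n. w l * U $$ (l, j)) - w i / (\<alpha> * \<beta>) * (\<Sum>l<n. p l * U $$ (l, j))"
        by (simp add: p'_def w'_def sum_distrib_left sum_subtractf algebra_simps)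
      ultimately show ?thesis
        unfolding V_def mult_entry[OF R U ij] wU[OF ij(2)] pU[OF ij(2)] dir[OF ij]
        by (cases "j = b") simp_all
    qed
    show ?thesis
    proof (rule that[of "1 / (\<alpha> * \<beta>)" V Y])
      show "V 0 = U" "Y 0 = W" using U W by (simp_all add: V_def Y_def R0)
      show "projection_factors n r (V t) (Y t)" for t
        unfolding V_def Y_def R_def
        by (rule projection_factors_orthogonal[OF pf])
          (simp_all add: plane_rotation_orthogonal on1 on2 on3)
    qed (use \<alpha> \<beta> Vel VYel der in auto)
  qed
qed

section \<open>Stationary points\<close>

abbreviation differential_at ::
  "nat list \<Rightarrow> (nat list \<Rightarrow> tensor \<Rightarrow> real) \<Rightarrow> tensor \<Rightarrow> real mat list \<Rightarrow> tensor \<Rightarrow> real" where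
  "differential_at ns F G Us \<equiv> tensor_differential ns F (multi_mode_prod G Us)"

section \<open>Expansion in unit tensors and matrix units\<close>

definition tensor_unit :: "nat list \<Rightarrow> tensor" where
  "tensor_unit i = (\<lambda>j. if j = i then 1 else 0)"

lemma tensor_unit_in_tensors: "i \<in> index_box ns \<Longrightarrow> tensor_unit i \<in> tensors ns"
  by (auto simp: tensor_unit_def tensors_def)

lemma tensor_differential_sum:
  "tensor_differential ns F X (\<lambda>j. \<Sum>i\<in>S. c i * Y i j) = (\<Sum>i\<in>S. c i * tensor_differential ns F X (Y i))"
proof (induction S rule: infinite_finite_induct)
  case (insert x S)
  then show ?case
    using tensor_differential_lincomb[of ns F X "c x" "Y x" 1 "\<lambda>j. \<Sum>i\<in>S. c i * Y i j"] by simp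
qed simp_all

lemma partial_mode_prod_zero: "partial_mode_prod m (\<lambda>i. 0) As = (\<lambda>i. 0)"
  using partial_mode_prod_smult[of m 0 "\<lambda>i. 0" As] by simp

lemma partial_mode_prod_sum:
  "partial_mode_prod m (\<lambda>j. \<Sum>i\<in>S. c i * Y i j) As = (\<lambda>j. \<Sum>i\<in>S. c i * partial_mode_prod m (Y i) As j)"
proof (induction S rule: infinite_finite_induct)
  case (insert x S)
  then show ?case
    using partial_mode_prod_lincomb[of m "c x" "Y x" 1 "\<lambda>j. \<Sum>i\<in>S. c i * Y i j" As] by simp
qed (simp_all add: partial_mode_prod_zero)

lemma tensor_eq_sum_units:
  assumes "H \<in> tensors ns"
  shows "H = (\<lambda>j. \<Sum>i\<in>index_box ns. H i * tensor_unit i j)"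
proof
  fix j
  have "(\<Sum>i\<in>index_box ns. H i * tensor_unit i j) = (\<Sum>i\<in>index_box ns. if i = j then H i else 0)"
    by (intro sum.cong) (auto simp: tensor_unit_def)
  then show "H j = (\<Sum>i\<in>index_box ns. H i * tensor_unit i j)"
    using assms by (auto simp: finite_index_box tensors_def)
qed

lemma multi_mode_prod_eq_sum_units:
  assumes "H \<in> tensors rs"
  shows "multi_mode_prod H Us = (\<lambda>j. \<Sum>i\<in>index_box rs. H i * multi_mode_prod (tensor_unit i) Us j)"
  unfolding multi_mode_prod_eq_partial
  by (subst tensor_eq_sum_units[OF assms]) (rule partial_mode_prod_sum)

lemma mode_prod_eq_sum_units:
  assumes "V \<in> carrier_mat n r"
  shows "mode_prod Y k V = (\<lambda>i. \<Sum>(a, b)\<in>{..<n} \<times> {..<r}. V $$ (a, b) * mode_prod Y k (mat_unit n r a b) i)"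
proof
  fix i
  show "mode_prod Y k V i = (\<Sum>(a, b)\<in>{..<n} \<times> {..<r}. V $$ (a, b) * mode_prod Y k (mat_unit n r a b) i)"
  proof (cases "k < length i \<and> i ! k < n")
    case True
    have E: "mode_prod Y k (mat_unit n r a b) i = (if a = i ! k then Y (i[k := b]) else 0)"
      if "b < r" for a b
    proof -
      have "mode_prod Y k (mat_unit n r a b) i
          = (\<Sum>l<r. (if (i ! k, l) = (a, b) then 1 else 0) * Y (i[k := l]))"
        using True by (simp add: mode_prod_def mat_unit_def)
      then show ?thesis using that by (cases "a = i ! k") (simp_all add: mult_delta_left)
    qed
    have "(\<Sum>(a, b)\<in>{..<n} \<times> {..<r}. V $$ (a, b) * mode_prod Y k (mat_unit n r a b) i)
        = (\<Sum>a<n. \<Sum>b<r. V $$ (a, b) * mode_prod Y k (mat_unit n r a b) i)"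
      by (simp add: sum.cartesian_product)
    also have "\<dots> = (\<Sum>a<n. if a = i ! k then (\<Sum>b<r. V $$ (a, b) * Y (i[k := b])) else 0)"
      by (intro sum.cong) (auto simp: E)
    also have "\<dots> = mode_prod Y k V i" using True assms by (simp add: mode_prod_def)
    finally show ?thesis by simp
  next
    case False
    then show ?thesis using assms by (auto simp: mode_prod_def mat_unit_def intro!: sum.neutral[symmetric])
  qed
qed

text \<open>
  First-order stationarity for \<open>f \<circ> tucker_phi\<close>, with the partial derivatives collected into
  directional ones.
\<close>

definition tucker_critical ::
  "nat list \<Rightarrow> nat list \<Rightarrow> (nat list \<Rightarrow> tensor \<Rightarrow> real) \<Rightarrow> tensor \<Rightarrow> real mat list \<Rightarrow> bool" where
  "tucker_critical ns rs F G Us \<longleftrightarrow>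
     (\<forall>H\<in>tensors rs. differential_at ns F G Us (multi_mode_prod H Us) = 0) \<and>
     (\<forall>k<length ns. \<forall>V\<in>carrier_mat (ns ! k) (rs ! k).
        differential_at ns F G Us (mode_prod (mode_prod_except G Us k (rs ! k)) k V) = 0)"

text \<open>Both conditions are linear in the direction, so they may be tested on a basis; the basis
  directions are the ones that partial derivatives see.\<close>

lemma tucker_critical_units_iff:
  "tucker_critical ns rs F G Us \<longleftrightarrow>
     (\<forall>i\<in>index_box rs. differential_at ns F G Us (multi_mode_prod (tensor_unit i) Us) = 0) \<and>
     (\<forall>k<length ns. \<forall>a<ns ! k. \<forall>b<rs ! k. differential_at ns F G Us
        (mode_prod (mode_prod_except G Us k (rs ! k)) k (mat_unit (ns ! k) (rs ! k) a b)) = 0)"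
  (is "_ \<longleftrightarrow> ?core \<and> ?factors")
proof
  assume "tucker_critical ns rs F G Us"
  then show "?core \<and> ?factors" by (simp add: tucker_critical_def tensor_unit_in_tensors)
next
  assume *: "?core \<and> ?factors"
  have "differential_at ns F G Us (multi_mode_prod H Us) = 0" if H: "H \<in> tensors rs" for H
    using * unfolding multi_mode_prod_eq_sum_units[OF H] tensor_differential_sum by simp
  moreover have "differential_at ns F G Us (mode_prod (mode_prod_except G Us k (rs ! k)) k V) = 0"
    if k: "k < length ns" and V: "V \<in> carrier_mat (ns ! k) (rs ! k)" for k V
    using * k unfolding mode_prod_eq_sum_units[OF V] case_prod_unfold tensor_differential_sum
    by (intro sum.neutral) auto
  ultimately show "tucker_critical ns rs F G Us" by (simp add: tucker_critical_def)
qed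

lemma multi_mode_prod_in_tensors:
  assumes "(G, Us) \<in> tucker_space ns rs" "length rs = length ns"
  shows "multi_mode_prod G Us \<in> tensors ns"
  using assms partial_mode_prod_full_in_tensors[of G rs ns Us]
  by (auto simp: tucker_space_def multi_mode_prod_eq_partial)

lemma mode_prod_except_in_tensors:
  assumes GU: "(G, Us) \<in> tucker_space ns rs" and len: "length rs = length ns"
    and k: "k < length ns" and V: "V \<in> carrier_mat (ns ! k) (rs ! k)"
  shows "mode_prod (mode_prod_except G Us k (rs ! k)) k V \<in> tensors ns"
proof -
  have "(G, Us[k := V]) \<in> tucker_space ns rs"
    using GU V k by (auto simp: tucker_space_def nth_list_update)
  then show ?thesis
    using mode_prod_mode_prod_except[of k Us V "rs ! k" G] multi_mode_prod_in_tensors[OF _ len] GU k V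
    by (auto simp: tucker_space_def)
qed

lemma has_real_derivative_iff_eq:
  fixes g :: "real \<Rightarrow> real"
  assumes "(g has_real_derivative D) (at a)"
  shows "(g has_real_derivative E) (at a) \<longleftrightarrow> D = E"
  using assms DERIV_unique by auto

text \<open>The Tucker map is affine in each single entry of the core and of the factors. Varying
  one entry therefore moves the tensor along a straight line, and the partial derivative is the
  differential in the direction of that line.\<close>

lemma tucker_stationary_iff_critical:
  assumes F: "C1_partials ns f F" and len: "length rs = length ns"
  shows "(G, Us) \<in> tucker_stationary_points ns rs (f \<circ> tucker_phi) \<longleftrightarrow>
    (G, Us) \<in> tucker_space ns rs \<and> tucker_critical ns rs F G Us"
proof -
  have "has_tucker_gradient ns rs (f \<circ> tucker_phi) (G, Us)
       ((\<lambda>i. 0), map (\<lambda>k. 0\<^sub>m (ns ! k) (rs ! k)) [0..<length ns]) \<longleftrightarrow> tucker_critical ns rs F G Us"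
    if GU: "(G, Us) \<in> tucker_space ns rs"
  proof -
    have X: "multi_mode_prod G Us \<in> tensors ns" by (rule multi_mode_prod_in_tensors[OF GU len])
    have core: "((\<lambda>t. (f \<circ> tucker_phi) (G(i := t), Us)) has_real_derivative 0) (at (G i)) \<longleftrightarrow>
        differential_at ns F G Us (multi_mode_prod (tensor_unit i) Us) = 0"
      if i: "i \<in> index_box rs" for i
    proof -
      have "G(i := t) = (\<lambda>j. 1 * G j + (t - G i) * tensor_unit i j)" for t
        by (auto simp: tensor_unit_def)
      then have eq: "(f \<circ> tucker_phi) (G(i := t), Us)
          = f (\<lambda>j. multi_mode_prod G Us j + (t - G i) * multi_mode_prod (tensor_unit i) Us j)" for t
        using partial_mode_prod_lincomb[of "length Us" 1 G "t - G i" "tensor_unit i" Us]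
        by (simp add: tucker_phi_def multi_mode_prod_eq_partial)
      have "(tensor_unit i, Us) \<in> tucker_space ns rs"
        using GU i by (simp add: tucker_space_def tensor_unit_in_tensors)
      note line = has_real_derivative_along_line[OF F X multi_mode_prod_in_tensors[OF this len], of "G i"]
      show ?thesis unfolding eq by (rule has_real_derivative_iff_eq[OF line])
    qed
    have factor: "((\<lambda>t. (f \<circ> tucker_phi) (G, Us[k := update_mat (Us ! k) (a, b) t]))
          has_real_derivative 0) (at ((Us ! k) $$ (a, b))) \<longleftrightarrow>
        differential_at ns F G Us (mode_prod (mode_prod_except G Us k (rs ! k)) k
          (mat_unit (ns ! k) (rs ! k) a b)) = 0"
      if k: "k < length ns" and ab: "a < ns ! k" "b < rs ! k" for k a b
    proof -
      let ?Y = "mode_prod_except G Us k (rs ! k)"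
      let ?E = "mat_unit (ns ! k) (rs ! k) a b"
      have U: "Us ! k \<in> carrier_mat (ns ! k) (rs ! k)" and lU: "length Us = length ns"
        using GU k by (auto simp: tucker_space_def)
      have upd: "update_mat (Us ! k) (a, b) t = Us ! k + (t - (Us ! k) $$ (a, b)) \<cdot>\<^sub>m ?E" for t
        using U ab by (intro eq_matI) (auto simp: update_mat_def mat_unit_def)
      have Yk: "mode_prod ?Y k (Us ! k) = multi_mode_prod G Us"
        using mode_prod_mode_prod_except[of k Us "Us ! k" "rs ! k" G] U k lU by simp
      have "multi_mode_prod G (Us[k := update_mat (Us ! k) (a, b) t])
          = mode_prod ?Y k (update_mat (Us ! k) (a, b) t)" for t
        using mode_prod_mode_prod_except[of k Us "update_mat (Us ! k) (a, b) t" "rs ! k" G] U k lU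
        by (simp add: update_mat_def)
      then have eq: "(f \<circ> tucker_phi) (G, Us[k := update_mat (Us ! k) (a, b) t])
          = f (\<lambda>i. multi_mode_prod G Us i + (t - (Us ! k) $$ (a, b)) * mode_prod ?Y k ?E i)" for t
        using mode_prod_add_right[OF U smult_carrier_mat[OF mat_unit_carrier], of ?Y k]
        by (simp add: tucker_phi_def upd mode_prod_smult_right Yk)
      have "mode_prod ?Y k ?E \<in> tensors ns"
        by (rule mode_prod_except_in_tensors[OF GU len k mat_unit_carrier])
      note line = has_real_derivative_along_line[OF F X this, of "(Us ! k) $$ (a, b)"]
      show ?thesis unfolding eq by (rule has_real_derivative_iff_eq[OF line])
    qed
    have "((\<lambda>i. 0), map (\<lambda>k. 0\<^sub>m (ns ! k) (rs ! k)) [0..<length ns]) \<in> tucker_space ns rs"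
      by (simp add: tucker_space_def tensors_def)
    then show ?thesis
      unfolding has_tucker_gradient_def tucker_critical_units_iff using core factor by simp
  qed
  then show ?thesis by (auto simp: tucker_stationary_points_def)
qed

section \<open>Points of the manifold built from factor matrices\<close>

definition compatible_factors :: "nat list \<Rightarrow> nat list \<Rightarrow> real mat list \<Rightarrow> real mat list \<Rightarrow> bool" where
  "compatible_factors ns rs Us Ws \<longleftrightarrow> length Us = length ns \<and> length Ws = length ns \<and>
     (\<forall>k<length ns. projection_factors (ns ! k) (rs ! k) (Us ! k) (Ws ! k))"

definition complement_projections :: "nat list \<Rightarrow> real mat list \<Rightarrow> real mat list \<Rightarrow> real mat list" where
  "complement_projections ns Us Ws = map (\<lambda>k. 1\<^sub>m (ns ! k) - Us ! k * Ws ! k) [0..<length ns]"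

lemma compatible_factors_tucker_space:
  "compatible_factors ns rs Us Ws \<Longrightarrow> (G, Us) \<in> tucker_space ns rs \<longleftrightarrow> G \<in> tensors rs"
  by (auto simp: compatible_factors_def tucker_space_def projection_factors_def)

text \<open>The constraint in mode \<open>k\<close> holds because the complement of the projection
  annihilates \<open>Us ! k\<close>.\<close>

lemma compatible_factors_manifold:
  assumes G: "G \<in> tensors rs" and len: "length rs = length ns" and UW: "compatible_factors ns rs Us Ws"
  shows "(multi_mode_prod G Us, complement_projections ns Us Ws) \<in> manifold ns rs"
proof -
  have GU: "(G, Us) \<in> tucker_space ns rs" using compatible_factors_tucker_space[OF UW] G by simp
  have "mode_prod (multi_mode_prod G Us) k (1\<^sub>m (ns ! k) - Us ! k * Ws ! k) = (\<lambda>i. 0)"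
    if k: "k < length ns" for k
  proof -
    have pf: "projection_factors (ns ! k) (rs ! k) (Us ! k) (Ws ! k)"
      using UW k by (simp add: compatible_factors_def)
    have "mode_prod (multi_mode_prod G Us) k (1\<^sub>m (ns ! k) - Us ! k * Ws ! k)
        = mode_prod (mode_prod_except G Us k (rs ! k)) k (0\<^sub>m (ns ! k) (rs ! k))"
      using GU k pf by (subst mode_prod_multi_mode_prod[of k Us "ns ! k" "rs ! k"])
        (auto simp: tucker_space_def projection_factors_mult(2) projection_factors_def)
    then show ?thesis by (simp add: mode_prod_zero_right)
  qed
  then show ?thesis
    using multi_mode_prod_in_tensors[OF GU len] UW
    by (auto simp: manifold_def complement_projections_def compatible_factors_def projection_factors_Gr)
qed

text \<open>The derivative along the curve is computed twice, by the chain rule and by the vanishing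
  gradient.\<close>

lemma stationary_imp_differential_zero:
  assumes F: "C1_partials ns f F"
    and x: "x \<in> stationary_points ns rs (f \<circ> phi)" and c: "curve_through ns rs x c"
    and z: "\<And>i. i \<in> index_box ns \<Longrightarrow> ((\<lambda>t. fst (c t) i) has_real_derivative z i) (at 0)"
  shows "tensor_differential ns F (fst x) z = 0"
proof -
  obtain \<epsilon> where \<epsilon>: "\<epsilon> > 0" and M: "\<And>t. \<bar>t\<bar> < \<epsilon> \<Longrightarrow> c t \<in> manifold ns rs"
    using c by (auto simp: curve_through_def abs_less_iff)
  have c0: "c 0 = x" using c by (simp add: curve_through_def)
  have "((\<lambda>t. f (fst (c t))) has_real_derivative tensor_differential ns F (fst (c 0)) z) (at 0)"
    by (rule chain_rule_tensor[OF F \<epsilon> _ z]) (use M in \<open>fastforce simp: manifold_def\<close>)+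
  moreover have "((\<lambda>t. (f \<circ> phi) (c t)) has_real_derivative
      inner_E ns (zero_E ns) (velocity ns c)) (at 0)"
    using x c by (simp add: stationary_points_def has_riemannian_gradient_def)
  moreover have "inner_E ns (zero_E ns) (velocity ns c) = 0"
    by (simp add: inner_E_def zero_E_def)
  ultimately show ?thesis using c0 by (simp add: phi_def) (metis DERIV_unique)
qed

lemma stationary_pointI:
  assumes F: "C1_partials ns f F" and x: "x \<in> manifold ns rs"
    and D: "\<And>c. curve_through ns rs x c \<Longrightarrow> tensor_differential ns F (fst x) (fst (velocity ns c)) = 0"
  shows "x \<in> stationary_points ns rs (f \<circ> phi)"
proof -
  \<comment> \<open>A gradient has to be a tangent vector; the constant curve shows that zero is
    one.\<close>
  have const: "curve_through ns rs x (\<lambda>t. x)"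
    using x by (auto simp: curve_through_def intro!: exI[of _ 1] elementary_smooth elementary.const)
  have "velocity ns (\<lambda>t. x) = zero_E ns"
    by (auto simp: velocity_def zero_E_def intro!: nth_equalityI eq_matI)
  then have "zero_E ns \<in> tangent_space ns rs x"
    using const by (auto simp: tangent_space_def) (metis)
  moreover have "((\<lambda>t. (f \<circ> phi) (c t)) has_real_derivative
      inner_E ns (zero_E ns) (velocity ns c)) (at 0)" if c: "curve_through ns rs x c" for c
  proof -
    obtain \<epsilon> where \<epsilon>: "\<epsilon> > 0" and M: "\<And>t. \<bar>t\<bar> < \<epsilon> \<Longrightarrow> c t \<in> manifold ns rs"
      and S: "\<And>i. i \<in> index_box ns \<Longrightarrow> smooth_real_on {-\<epsilon><..<\<epsilon>} (\<lambda>t. fst (c t) i)"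
      using c by (auto simp: curve_through_def abs_less_iff)
    have c0: "c 0 = x" using c by (simp add: curve_through_def)
    have "((\<lambda>t. fst (c t) i) has_real_derivative fst (velocity ns c) i) (at 0)"
      if i: "i \<in> index_box ns" for i
    proof -
      have "(\<lambda>t. fst (c t) i) field_differentiable at 0"
        using S[OF i] \<epsilon> by (auto simp: smooth_real_on_def dest: spec[of _ "0::nat"])
      then show ?thesis
        using i by (simp add: velocity_def DERIV_deriv_iff_field_differentiable)
    qed
    then have "((\<lambda>t. f (fst (c t))) has_real_derivative
        tensor_differential ns F (fst (c 0)) (fst (velocity ns c))) (at 0)"
      by (intro chain_rule_tensor[OF F \<epsilon>]) (use M in \<open>fastforce simp: manifold_def\<close>)+
    moreover have "inner_E ns (zero_E ns) (velocity ns c) = 0"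
      by (simp add: inner_E_def zero_E_def)
    ultimately show ?thesis using D[OF c] c0 by (simp add: phi_def o_def)
  qed
  ultimately show ?thesis using x by (simp add: stationary_points_def has_riemannian_gradient_def)
qed

text \<open>Differentiating the constraint \<open>X \<times>\<^sub>k P\<^sub>k = 0\<close> along a curve in the manifold.\<close>

lemma velocity_constraint:
  assumes c: "curve_through ns rs (X, Ps) c" and k: "k < length ns"
  shows "mode_prod (fst (velocity ns c)) k (Ps ! k) i + mode_prod X k (snd (velocity ns c) ! k) i = 0"
proof -
  obtain \<epsilon> where \<epsilon>: "\<epsilon> > 0" and M: "\<And>t. \<bar>t\<bar> < \<epsilon> \<Longrightarrow> c t \<in> manifold ns rs"
    and S: "\<And>i. i \<in> index_box ns \<Longrightarrow> smooth_real_on {-\<epsilon><..<\<epsilon>} (\<lambda>t. fst (c t) i)"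
    and SP: "\<And>a b. a < ns ! k \<Longrightarrow> b < ns ! k \<Longrightarrow> smooth_real_on {-\<epsilon><..<\<epsilon>} (\<lambda>t. (snd (c t) ! k) $$ (a, b))"
    using c k by (auto simp: curve_through_def abs_less_iff)
  have c0: "c 0 = (X, Ps)" using c by (simp add: curve_through_def)
  have X: "fst (c t) \<in> tensors ns" and P: "snd (c t) ! k \<in> carrier_mat (ns ! k) (ns ! k)"
    and XP: "mode_prod (fst (c t)) k (snd (c t) ! k) = (\<lambda>i. 0)" if "\<bar>t\<bar> < \<epsilon>" for t
    using M[OF that] k by (auto simp: manifold_def Gr_def split: prod.splits)
  have X0: "X \<in> tensors ns" and P0: "Ps ! k \<in> carrier_mat (ns ! k) (ns ! k)"
    using X[of 0] P[of 0] \<epsilon> c0 by auto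
  have v: "fst (velocity ns c) \<in> tensors ns" by (simp add: velocity_def tensors_def)
  have vP: "snd (velocity ns c) ! k \<in> carrier_mat (ns ! k) (ns ! k)" using k by (simp add: velocity_def)
  show ?thesis
  proof (cases "i \<in> index_box ns")
    case True
    then have ik: "k < length i" "i ! k < ns ! k" using k by (auto simp: index_box_def)
    have DX: "((\<lambda>t. fst (c t) (i[k := l])) has_real_derivative fst (velocity ns c) (i[k := l])) (at 0)"
      if "l < ns ! k" for l
    proof -
      have il: "i[k := l] \<in> index_box ns" using list_update_in_index_box[of i ns l k] True that by simp
      have "(\<lambda>t. fst (c t) (i[k := l])) field_differentiable at 0"
        using S[OF il] \<epsilon> by (auto simp: smooth_real_on_def dest: spec[of _ "0::nat"])
      then show ?thesis using il by (simp add: velocity_def DERIV_deriv_iff_field_differentiable)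
    qed
    have DP: "((\<lambda>t. (snd (c t) ! k) $$ (i ! k, l)) has_real_derivative
        (snd (velocity ns c) ! k) $$ (i ! k, l)) (at 0)" if l: "l < ns ! k" for l
    proof -
      have "(\<lambda>t. (snd (c t) ! k) $$ (i ! k, l)) field_differentiable at 0"
        using SP[OF ik(2) l] \<epsilon> by (auto simp: smooth_real_on_def dest: spec[of _ "0::nat"])
      then show ?thesis using ik l k by (simp add: velocity_def DERIV_deriv_iff_field_differentiable)
    qed
    have "((\<lambda>t. \<Sum>l<ns ! k. (snd (c t) ! k) $$ (i ! k, l) * fst (c t) (i[k := l])) has_real_derivative
        (\<Sum>l<ns ! k. (snd (velocity ns c) ! k) $$ (i ! k, l) * fst (c 0) (i[k := l])
          + fst (velocity ns c) (i[k := l]) * (snd (c 0) ! k) $$ (i ! k, l))) (at 0)"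
      by (rule DERIV_sum) (use DX DP in \<open>auto intro!: DERIV_mult\<close>)
    moreover have "((\<lambda>t. \<Sum>l<ns ! k. (snd (c t) ! k) $$ (i ! k, l) * fst (c t) (i[k := l]))
        has_real_derivative 0) (at 0)"
    proof (rule has_field_derivative_transform_within[OF DERIV_const[of 0] \<epsilon>])
      fix t :: real assume "dist t 0 < \<epsilon>"
      then have t: "\<bar>t\<bar> < \<epsilon>" by simp
      show "0 = (\<Sum>l<ns ! k. (snd (c t) ! k) $$ (i ! k, l) * fst (c t) (i[k := l]))"
        using fun_cong[OF XP[OF t], of i] P[OF t] ik by (simp add: mode_prod_def)
    qed simp
    ultimately have "(\<Sum>l<ns ! k. (snd (velocity ns c) ! k) $$ (i ! k, l) * X (i[k := l])
          + fst (velocity ns c) (i[k := l]) * (Ps ! k) $$ (i ! k, l)) = 0"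
      using DERIV_unique c0 by fastforce
    then show ?thesis
      using ik P0 vP by (simp add: mode_prod_def sum.distrib mult.commute)
  next
    case False
    then show ?thesis
      using mode_prod_square_in_tensors[OF v k P0] mode_prod_square_in_tensors[OF X0 k vP]
      by (simp add: tensors_def)
  qed
qed

section \<open>From Tucker stationarity to stationarity on the manifold\<close>

lemma compatible_factorsD:
  assumes "compatible_factors ns rs Us Ws" "k < length ns"
  shows "projection_factors (ns ! k) (rs ! k) (Us ! k) (Ws ! k)"
    "Us ! k \<in> carrier_mat (ns ! k) (rs ! k)" "Ws ! k \<in> carrier_mat (rs ! k) (ns ! k)"
    "Us ! k * Ws ! k \<in> carrier_mat (ns ! k) (ns ! k)"
    "k < length Us" "dim_col (Us ! k) = rs ! k" "dim_row (Ws ! k) = rs ! k"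
  using assms by (auto simp: compatible_factors_def projection_factors_def)

lemma critical_imp_stationary:
  assumes F: "C1_partials ns f F" and len: "length rs = length ns"
    and UW: "compatible_factors ns rs Us Ws" and G: "G \<in> tensors rs"
    and crit: "tucker_critical ns rs F G Us"
  shows "(multi_mode_prod G Us, complement_projections ns Us Ws) \<in> stationary_points ns rs (f \<circ> phi)"
proof (rule stationary_pointI[OF F compatible_factors_manifold[OF G len UW]])
  fix c
  let ?d = "length ns"
  let ?X = "multi_mode_prod G Us"
  let ?L = "tensor_differential ns F ?X"
  assume c: "curve_through ns rs (?X, complement_projections ns Us Ws) c"
  define X' where "X' = fst (velocity ns c)"
  define P' where "P' k = snd (velocity ns c) ! k" for k
  define Qs where "Qs = map (\<lambda>k. Us ! k * Ws ! k) [0..<?d]"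
  have X'T: "X' \<in> tensors ns" by (simp add: X'_def velocity_def tensors_def)
  have P'C: "P' k \<in> carrier_mat (ns ! k) (ns ! k)" if "k < ?d" for k
    using that by (simp add: P'_def velocity_def)
  have Q: "Qs ! k = Us ! k * Ws ! k" if "k < ?d" for k using that by (simp add: Qs_def)
  have XA: "mode_prod ?X k A = mode_prod (mode_prod_except G Us k (rs ! k)) k (A * Us ! k)"
    if "k < ?d" "A \<in> carrier_mat (ns ! k) (ns ! k)" for k A
    using mode_prod_multi_mode_prod[of k Us "ns ! k" "rs ! k" A G] compatible_factorsD[OF UW that(1)] that
    by auto
  have XQ: "mode_prod ?X k (Qs ! k) = ?X" if k: "k < ?d" for k
    using XA[OF k, of "Qs ! k"] compatible_factorsD[OF UW k] Q[OF k]
      projection_factors_mult(1)[OF compatible_factorsD(1)[OF UW k]]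
      mode_prod_mode_prod_except[of k Us "Us ! k" "rs ! k" G] by auto
  have XP': "?L (mode_prod ?X k (P' k)) = 0" if k: "k < ?d" for k
    using crit k XA[OF k P'C[OF k]] mult_carrier_mat[OF P'C[OF k] compatible_factorsD(2)[OF UW k]]
    by (simp add: tucker_critical_def)
  have X'Q: "mode_prod X' k (Qs ! k) = (\<lambda>i. X' i + mode_prod ?X k (P' k) i)" if k: "k < ?d" for k
  proof -
    let ?P = "1\<^sub>m (ns ! k) - Qs ! k"
    have QC: "Qs ! k \<in> carrier_mat (ns ! k) (ns ! k)" using compatible_factorsD(4)[OF UW k] Q[OF k] by simp
    have "mode_prod X' k (Qs ! k + ?P) = mode_prod X' k (1\<^sub>m (ns ! k))"
      using QC by (intro arg_cong[of _ _ "mode_prod X' k"] eq_matI) auto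
    then have "X' = (\<lambda>i. mode_prod X' k (Qs ! k) i + mode_prod X' k ?P i)"
      using mode_prod_add_right[OF QC minus_carrier_mat[OF QC]] mode_prod_one[OF X'T k] by simp
    then have "X' i = mode_prod X' k (Qs ! k) i + mode_prod X' k ?P i" for i by metis
    moreover have "mode_prod X' k ?P i + mode_prod ?X k (P' k) i = 0" for i
      using velocity_constraint[OF c k, of i] k Q[OF k]
      by (simp add: X'_def P'_def complement_projections_def)
    ultimately show ?thesis by (auto simp: fun_eq_iff algebra_simps)
  qed
  \<comment> \<open>The projections are applied to \<open>X'\<close> one mode at a time, each step
    adding a term that \<open>?L\<close> annihilates.\<close>
  have "?L (partial_mode_prod m X' Qs) = ?L X'" if "m \<le> ?d" for m
    using that
  proof (induction m)
    case (Suc m)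
    then have m: "m < ?d" by simp
    \<comment> \<open>The correction \<open>mode_prod ?X m (P' m)\<close> passes unchanged through
      the earlier projections, because they fix \<open>?X\<close> and act in other modes.\<close>
    have XQm: "partial_mode_prod m ?X Qs = ?X"
      using m by (intro partial_mode_prod_id XQ) auto
    have "partial_mode_prod (Suc m) X' Qs = partial_mode_prod m (mode_prod X' m (Qs ! m)) Qs"
      by (simp add: partial_mode_prod_mode_prod_commute)
    also have "\<dots> = (\<lambda>i. partial_mode_prod m X' Qs i + mode_prod ?X m (P' m) i)"
      unfolding X'Q[OF m] partial_mode_prod_add
      by (simp add: partial_mode_prod_mode_prod_commute XQm)
    finally show ?case using Suc XP'[OF m] by (simp add: tensor_differential_add)
  qed simp
  from this[of ?d] have "?L X' = ?L (partial_mode_prod ?d X' Qs)" by simp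
  \<comment> \<open>Splitting each projection as \<open>Us ! k * Ws ! k\<close> exhibits the
    projected velocity as a core direction, with core \<open>X'\<close> multiplied by all
    \<open>Ws\<close>.\<close>
  also have "partial_mode_prod ?d X' Qs = multi_mode_prod (partial_mode_prod ?d X' Ws) Us"
  proof -
    have "partial_mode_prod ?d (partial_mode_prod ?d X' Ws) Us = partial_mode_prod ?d X' Qs"
      using compatible_factorsD[OF UW] Q by (intro partial_mode_prod_compose) auto
    then show ?thesis using UW by (simp add: multi_mode_prod_eq_partial compatible_factors_def)
  qed
  also have "?L \<dots> = 0"
  proof -
    have "partial_mode_prod (length rs) X' Ws \<in> tensors rs"
      using len X'T compatible_factorsD(3)[OF UW] by (intro partial_mode_prod_full_in_tensors) auto
    then show ?thesis using crit len by (simp add: tucker_critical_def)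
  qed
  finally show "tensor_differential ns F (fst (?X, complement_projections ns Us Ws)) (fst (velocity ns c)) = 0"
    by (simp add: X'_def)
qed

section \<open>From stationarity on the manifold to Tucker stationarity\<close>

lemma curve_throughI:
  assumes "c 0 = x" "\<And>t. c t \<in> manifold ns rs"
    and "\<And>i. i \<in> index_box ns \<Longrightarrow> elementary (\<lambda>t. fst (c t) i)"
    and "\<And>k a b. k < length ns \<Longrightarrow> a < ns ! k \<Longrightarrow> b < ns ! k \<Longrightarrow> elementary (\<lambda>t. (snd (c t) ! k) $$ (a, b))"
  shows "curve_through ns rs x c"
  using assms by (auto simp: curve_through_def intro!: exI[of _ 1] elementary_smooth)

lemma stationary_imp_core_critical:
  assumes F: "C1_partials ns f F" and len: "length rs = length ns"
    and UW: "compatible_factors ns rs Us Ws" and G: "G \<in> tensors rs"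
    and x: "(multi_mode_prod G Us, complement_projections ns Us Ws) \<in> stationary_points ns rs (f \<circ> phi)"
    and H: "H \<in> tensors rs"
  shows "differential_at ns F G Us (multi_mode_prod H Us) = 0"
proof -
  define c where "c t = (multi_mode_prod (\<lambda>j. 1 * G j + t * H j) Us, complement_projections ns Us Ws)" for t :: real
  have c: "fst (c t) i = multi_mode_prod G Us i + t * multi_mode_prod H Us i" for t i
    by (simp only: c_def multi_mode_prod_eq_partial partial_mode_prod_lincomb) simp
  have "curve_through ns rs (multi_mode_prod G Us, complement_projections ns Us Ws) c"
  proof (rule curve_throughI)
    show "c t \<in> manifold ns rs" for t
      unfolding c_def by (rule compatible_factors_manifold[OF _ len UW]) (use G H in \<open>simp add: tensors_def\<close>)
    show "elementary (\<lambda>t. fst (c t) i)" for i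
      unfolding c by (intro elementary.intros)
  qed (simp_all add: c_def elementary.const)
  then have "tensor_differential ns F (fst (multi_mode_prod G Us, complement_projections ns Us Ws))
      (multi_mode_prod H Us) = 0"
    by (rule stationary_imp_differential_zero[OF F x]) (auto simp: c intro!: derivative_eq_intros)
  then show ?thesis by simp
qed

lemma stationary_imp_factor_critical:
  assumes F: "C1_partials ns f F" and len: "length rs = length ns"
    and UW: "compatible_factors ns rs Us Ws" and G: "G \<in> tensors rs"
    and x: "(multi_mode_prod G Us, complement_projections ns Us Ws) \<in> stationary_points ns rs (f \<circ> phi)"
    and k: "k < length ns" and ab: "a < ns ! k" "b < rs ! k"
  shows "differential_at ns F G Us (mode_prod (mode_prod_except G Us k (rs ! k)) k
    (mat_unit (ns ! k) (rs ! k) a b)) = 0"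
proof -
  let ?X = "multi_mode_prod G Us"
  let ?n = "ns ! k" and ?r = "rs ! k" and ?U = "Us ! k" and ?W = "Ws ! k"
  let ?Y = "mode_prod_except G Us k ?r" and ?E = "mat_unit (ns ! k) (rs ! k) a b"
  let ?L = "tensor_differential ns F ?X"
  note pf = compatible_factorsD(1)[OF UW k] and U = compatible_factorsD(2)[OF UW k]
    and W = compatible_factorsD(3)[OF UW k] and Q = compatible_factorsD(4)[OF UW k]
    and kU = compatible_factorsD(5)[OF UW k]
  obtain V Z \<sigma> where \<sigma>: "\<sigma> \<noteq> 0" and V0: "V 0 = ?U" "Z 0 = ?W"
    and VZ: "\<And>t. projection_factors ?n ?r (V t) (Z t)"
    and Vel: "\<And>i j. i < ?n \<Longrightarrow> j < ?r \<Longrightarrow> elementary (\<lambda>t. V t $$ (i, j))"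
    and VZel: "\<And>i j. i < ?n \<Longrightarrow> j < ?n \<Longrightarrow> elementary (\<lambda>t. (V t * Z t) $$ (i, j))"
    and Vder: "\<And>i j. i < ?n \<Longrightarrow> j < ?r \<Longrightarrow> ((\<lambda>t. V t $$ (i, j)) has_real_derivative
        \<sigma> * ((1\<^sub>m ?n - ?U * ?W) * ?E) $$ (i, j)) (at 0)"
    by (rule projection_factors_curve[OF pf ab]) (rule that; assumption)
  have V: "V t \<in> carrier_mat ?n ?r" and Z: "Z t \<in> carrier_mat ?r ?n" for t
    using VZ[of t] by (auto simp: projection_factors_def)
  \<comment> \<open>The core stays fixed while factor \<open>k\<close> and its left inverse move
    together, which keeps the curve in the manifold.\<close>
  define c where "c t = (multi_mode_prod G (Us[k := V t]),
    complement_projections ns (Us[k := V t]) (Ws[k := Z t]))" for t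
  have fst_c: "fst (c t) = mode_prod ?Y k (V t)" for t
    unfolding c_def by (simp add: mode_prod_mode_prod_except[OF kU carrier_matD(2)[OF V]])
  have fst_c_index: "fst (c t) i = (\<Sum>l<?r. V t $$ (i ! k, l) * ?Y (i[k := l]))"
    if "i \<in> index_box ns" for t i
    using that k unfolding fst_c mode_prod_def carrier_matD[OF V] index_box_def by simp
  have "compatible_factors ns rs (Us[k := V t]) (Ws[k := Z t])" for t
    using UW VZ[of t] k by (auto simp: compatible_factors_def nth_list_update)
  then have M: "c t \<in> manifold ns rs" for t
    unfolding c_def by (rule compatible_factors_manifold[OF G len])
  have c: "curve_through ns rs (?X, complement_projections ns Us Ws) c"
  proof (rule curve_throughI[OF _ M])
    show "c 0 = (?X, complement_projections ns Us Ws)" by (simp add: c_def V0)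
    show "elementary (\<lambda>t. fst (c t) i)" if i: "i \<in> index_box ns" for i
      unfolding fst_c_index[OF i] using i k
      by (intro elementary_sum elementary.mult elementary.const Vel) (auto simp: index_box_def)
    show "elementary (\<lambda>t. (snd (c t) ! k') $$ (a', b'))"
      if "k' < length ns" "a' < ns ! k'" "b' < ns ! k'" for k' a' b'
    proof (cases "k' = k")
      case True
      then have "(snd (c t) ! k') $$ (a', b') = 1\<^sub>m ?n $$ (a', b') - (V t * Z t) $$ (a', b')" for t
        using that kU UW V[of t] Z[of t] by (simp add: c_def complement_projections_def compatible_factors_def)
      then show ?thesis using VZel that True by (simp add: elementary_diff elementary.const)
    next
      case False
      then show ?thesis using that by (simp add: c_def complement_projections_def elementary.const)
    qed
  qed
  let ?P = "1\<^sub>m ?n - ?U * ?W"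
  have P: "?P \<in> carrier_mat ?n ?n" using Q by (rule minus_carrier_mat)
  have "?L (\<lambda>i. \<sigma> * mode_prod ?Y k (?P * ?E) i) = 0"
  proof (rule stationary_imp_differential_zero[OF F x c, simplified fst_conv])
    fix i assume i: "i \<in> index_box ns"
    then have ik: "k < length i" "i ! k < ?n" using k by (auto simp: index_box_def)
    have "((\<lambda>t. fst (c t) i) has_real_derivative
        (\<Sum>l<?r. (\<sigma> * (?P * ?E) $$ (i ! k, l)) * ?Y (i[k := l]))) (at 0)"
      unfolding fst_c_index[OF i]
      by (intro DERIV_sum DERIV_cmult_right Vder ik) simp
    moreover have "\<sigma> * mode_prod ?Y k (?P * ?E) i
        = (\<Sum>l<?r. (\<sigma> * (?P * ?E) $$ (i ! k, l)) * ?Y (i[k := l]))"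
      unfolding mode_prod_def carrier_matD[OF mult_carrier_mat[OF P mat_unit_carrier]]
        mult.assoc sum_distrib_left[symmetric] using ik by simp
    ultimately show "((\<lambda>t. fst (c t) i) has_real_derivative \<sigma> * mode_prod ?Y k (?P * ?E) i) (at 0)"
      by simp
  qed
  then have LP: "?L (mode_prod ?Y k (?P * ?E)) = 0" using \<sigma> by (simp add: tensor_differential_smult)
  have WE: "?W * ?E \<in> carrier_mat ?r ?r" by (rule mult_carrier_mat[OF W mat_unit_carrier])
  \<comment> \<open>The part of \<open>?E\<close> in the column space of \<open>?U\<close> acts like
    the core change \<open>mode_prod G k (?W * ?E)\<close>, for which the claim is known.\<close>
  have "?L (multi_mode_prod (mode_prod G k (?W * ?E)) Us) = 0"
    using mode_prod_square_in_tensors[OF G _ WE] k len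
    by (intro stationary_imp_core_critical[OF F len UW G x]) simp
  then have LQ: "?L (mode_prod ?Y k (?U * (?W * ?E))) = 0"
    using multi_mode_prod_mode_prod[OF kU U WE] by simp
  have "?E = ?P * ?E + ?U * (?W * ?E)"
  proof -
    have "?P * ?E = 1\<^sub>m ?n * ?E - (?U * ?W) * ?E"
      by (rule minus_mult_distrib_mat[OF one_carrier_mat Q mat_unit_carrier])
    then have "?P * ?E = ?E - ?U * (?W * ?E)"
      using assoc_mult_mat[OF U W mat_unit_carrier] left_mult_one_mat[OF mat_unit_carrier] by simp
    moreover have "A - M + M = A" if "A \<in> carrier_mat ?n ?r" "M \<in> carrier_mat ?n ?r" for A M :: "real mat"
      using that by (intro eq_matI) auto
    from this[OF mat_unit_carrier mult_carrier_mat[OF U WE]]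
    have "?E - ?U * (?W * ?E) + ?U * (?W * ?E) = ?E" .
    ultimately show ?thesis by simp
  qed
  then have "mode_prod ?Y k ?E = (\<lambda>i. mode_prod ?Y k (?P * ?E) i + mode_prod ?Y k (?U * (?W * ?E)) i)"
    using mode_prod_add_right[OF mult_carrier_mat[OF P mat_unit_carrier] mult_carrier_mat[OF U WE]]
    by metis
  then show ?thesis using LP LQ by (simp add: tensor_differential_add)
qed

lemma stationary_imp_critical:
  assumes "C1_partials ns f F" "length rs = length ns" "compatible_factors ns rs Us Ws" "G \<in> tensors rs"
    and "(multi_mode_prod G Us, complement_projections ns Us Ws) \<in> stationary_points ns rs (f \<circ> phi)"
  shows "tucker_critical ns rs F G Us"
  unfolding tucker_critical_units_iff
  using stationary_imp_core_critical[OF assms tensor_unit_in_tensors]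
    stationary_imp_factor_critical[OF assms] by blast

text \<open>Factorizing \<open>I - P_k\<close> as \<open>U_k W_k\<close> gives the factors, and
  multiplying \<open>X\<close> by all \<open>W_k\<close> gives the core. It reproduces
  \<open>X\<close> since the constraint \<open>X \<times>_k P_k = 0\<close> says that
  \<open>U_k W_k\<close> fixes \<open>X\<close> in mode \<open>k\<close>.\<close>

lemma manifold_imp_compatible_factors:
  assumes x: "(X, Ps) \<in> manifold ns rs" and len: "length rs = length ns"
    and r: "\<And>k. k < length ns \<Longrightarrow> rs ! k \<le> ns ! k"
  obtains G Us Ws where "compatible_factors ns rs Us Ws" "G \<in> tensors rs"
    "X = multi_mode_prod G Us" "Ps = complement_projections ns Us Ws"
proof -
  let ?d = "length ns"
  have X: "X \<in> tensors ns" and lP: "length Ps = ?d"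
    and P: "\<And>k. k < ?d \<Longrightarrow> Ps ! k \<in> Gr (ns ! k - rs ! k) (ns ! k)"
    and XP: "\<And>k. k < ?d \<Longrightarrow> mode_prod X k (Ps ! k) = (\<lambda>i. 0)"
    using x by (auto simp: manifold_def)
  have "\<exists>U W. projection_factors (ns ! k) (rs ! k) U W \<and> Ps ! k = 1\<^sub>m (ns ! k) - U * W" if "k < ?d" for k
    using Gr_projection_factors[OF P[OF that] r[OF that]] by metis
  then obtain U W where UW: "\<And>k. k < ?d \<Longrightarrow> projection_factors (ns ! k) (rs ! k) (U k) (W k)"
    "\<And>k. k < ?d \<Longrightarrow> Ps ! k = 1\<^sub>m (ns ! k) - U k * W k" by metis
  define Us where "Us = map U [0..<?d]"
  define Ws where "Ws = map W [0..<?d]"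
  have c: "compatible_factors ns rs Us Ws"
    using UW by (simp add: compatible_factors_def Us_def Ws_def)
  have Ps: "Ps = complement_projections ns Us Ws"
    using UW lP by (intro nth_equalityI) (auto simp: complement_projections_def Us_def Ws_def)
  define G where "G = partial_mode_prod ?d X Ws"
  have G: "G \<in> tensors rs"
    using partial_mode_prod_full_in_tensors[of X ns rs Ws] X len compatible_factorsD(3)[OF c]
    by (simp add: G_def)
  define Qs where "Qs = map (\<lambda>k. Us ! k * Ws ! k) [0..<?d]"
  have "mode_prod X k (Qs ! k) = X" if k: "k < ?d" for k
  proof -
    have Q: "Qs ! k \<in> carrier_mat (ns ! k) (ns ! k)"
      using compatible_factorsD(4)[OF c k] k by (simp add: Qs_def)
    have Pk: "Ps ! k = 1\<^sub>m (ns ! k) - Qs ! k"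
      using UW(2)[OF k] k by (simp add: Qs_def Us_def Ws_def)
    have "X = mode_prod X k (Qs ! k + Ps ! k)"
    proof -
      have "Qs ! k + Ps ! k = 1\<^sub>m (ns ! k)" unfolding Pk using Q by (intro eq_matI) auto
      then show ?thesis using mode_prod_one[OF X k] by simp
    qed
    also have "\<dots> = mode_prod X k (Qs ! k)"
      using mode_prod_add_right[OF Q, of "Ps ! k" X k] minus_carrier_mat[OF Q] XP[OF k] Pk by simp
    finally show ?thesis by simp
  qed
  then have "partial_mode_prod ?d X Qs = X" by (intro partial_mode_prod_id)
  moreover have "partial_mode_prod ?d G Us = partial_mode_prod ?d X Qs"
    unfolding G_def using compatible_factorsD[OF c]
    by (intro partial_mode_prod_compose) (auto simp: Qs_def)
  ultimately have "X = multi_mode_prod G Us"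
    using c by (simp add: multi_mode_prod_eq_partial compatible_factors_def)
  with that c G Ps show ?thesis by blast
qed

text \<open>The image on the Tucker side is restricted to factors of full column rank:
  \<open>rank_deficient_counterexample\<close> shows that the equality can fail otherwise.\<close>

theorem theorem2:
  fixes ns rs :: "nat list" and f :: "tensor \<Rightarrow> real"
  assumes "length rs = length ns"
    and "\<forall>k<length ns. 1 \<le> rs ! k \<and> rs ! k \<le> ns ! k"
    and "smooth_on_tensors ns f"
  shows "(\<forall>G Us Rs.
            (G, Us) \<in> tucker_stationary_points ns rs (f \<circ> tucker_phi) \<longrightarrow>
            length Rs = length ns \<longrightarrow>
            (\<forall>k<length ns. Rs ! k \<in> GL (rs ! k) \<and> Us ! k * Rs ! k \<in> St (rs ! k) (ns ! k)) \<longrightarrow>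
            represented_point (multi_mode_prod G (map inv_mat Rs)) (map2 (*) Us Rs)
              \<in> stationary_points ns rs (f \<circ> phi))
       \<and> phi ` stationary_points ns rs (f \<circ> phi)
           = tucker_phi ` (tucker_stationary_points ns rs (f \<circ> tucker_phi)
               \<inter> full_rank_factors ns rs)"
proof -
  note len = assms(1)
  obtain F where F: "C1_partials ns f F" using smooth_imp_C1_partials[OF assms(3)] .
  note crit = tucker_stationary_iff_critical[OF F len]
  show ?thesis
  proof (intro conjI allI impI)
    fix G Us Rs
    assume st: "(G, Us) \<in> tucker_stationary_points ns rs (f \<circ> tucker_phi)"
      and lR: "length Rs = length ns"
      and R: "\<forall>k<length ns. Rs ! k \<in> GL (rs ! k) \<and> Us ! k * Rs ! k \<in> St (rs ! k) (ns ! k)"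
    have GU: "(G, Us) \<in> tucker_space ns rs" using st crit by simp
    then have G: "G \<in> tensors rs" and lU: "length Us = length ns"
      and U: "\<And>k. k < length ns \<Longrightarrow> Us ! k \<in> carrier_mat (ns ! k) (rs ! k)"
      by (auto simp: tucker_space_def)
    have RC: "Rs ! k \<in> carrier_mat (rs ! k) (rs ! k)" if "k < length ns" for k
      using R that by (simp add: GL_def)
    \<comment> \<open>With this choice the complement projections are those of the represented
      point, although the factors stay \<open>Us\<close>; the matrices in \<open>Rs\<close> cancel
      in the tensor itself.\<close>
    define Ws where "Ws = map2 (\<lambda>U R. R * transpose_mat (U * R)) Us Rs"
    have c: "compatible_factors ns rs Us Ws"
      using lU lR U R by (auto simp: compatible_factors_def Ws_def intro!: orthonormalized_projection_factors)
    have "multi_mode_prod (multi_mode_prod G (map inv_mat Rs)) (map2 (*) Us Rs) = multi_mode_prod G Us"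
    proof -
      have "Us ! k = (Us ! k * Rs ! k) * inv_mat (Rs ! k)" if k: "k < length ns" for k
      proof -
        have Rk: "Rs ! k \<in> GL (rs ! k)" using R k by simp
        show ?thesis
          using assoc_mult_mat[OF U[OF k] RC[OF k] inv_mat(1)[OF Rk]] inv_mat(3)[OF Rk] U[OF k] by simp
      qed
      moreover have "dim_row (inv_mat (Rs ! k)) = rs ! k" if "k < length ns" for k
        using inv_mat(1) R that by blast
      ultimately show ?thesis
        using lU lR RC by (simp add: multi_mode_prod_eq_partial) (intro partial_mode_prod_compose, auto)
    qed
    moreover have "map (\<lambda>U. 1\<^sub>m (dim_row U) - U * transpose_mat U) (map2 (*) Us Rs)
        = complement_projections ns Us Ws"
    proof (rule nth_equalityI)
      fix k assume "k < length (map (\<lambda>U. 1\<^sub>m (dim_row U) - U * transpose_mat U) (map2 (*) Us Rs))"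
      then have k: "k < length ns" using lU by simp
      let ?T = "transpose_mat (Us ! k * Rs ! k)"
      have T: "?T \<in> carrier_mat (rs ! k) (ns ! k)" using U[OF k] RC[OF k] by simp
      show "map (\<lambda>U. 1\<^sub>m (dim_row U) - U * transpose_mat U) (map2 (*) Us Rs) ! k
          = complement_projections ns Us Ws ! k"
        using k lU lR carrier_matD[OF U[OF k]] assoc_mult_mat[OF U[OF k] RC[OF k] T]
        by (simp add: complement_projections_def Ws_def)
    qed (simp add: complement_projections_def lU lR)
    ultimately show "represented_point (multi_mode_prod G (map inv_mat Rs)) (map2 (*) Us Rs)
        \<in> stationary_points ns rs (f \<circ> phi)"
      using critical_imp_stationary[OF F len c G] st crit by (simp add: represented_point_def)
  next
    show "phi ` stationary_points ns rs (f \<circ> phi)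
      = tucker_phi ` (tucker_stationary_points ns rs (f \<circ> tucker_phi) \<inter> full_rank_factors ns rs)"
    proof (rule equalityI; rule subsetI)
      fix Z assume "Z \<in> phi ` stationary_points ns rs (f \<circ> phi)"
      then obtain Ps where x: "(Z, Ps) \<in> stationary_points ns rs (f \<circ> phi)" by (auto simp: phi_def)
      then have "(Z, Ps) \<in> manifold ns rs" by (simp add: stationary_points_def)
      then obtain G Us Ws where c: "compatible_factors ns rs Us Ws" and G: "G \<in> tensors rs"
        and Z: "Z = multi_mode_prod G Us" and Ps: "Ps = complement_projections ns Us Ws"
        using manifold_imp_compatible_factors[OF _ len] assms(2) by metis
      have GU: "(G, Us) \<in> tucker_space ns rs" using compatible_factors_tucker_space[OF c] G by simp
      have "tucker_critical ns rs F G Us"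
        using stationary_imp_critical[OF F len c G] x by (simp add: Z Ps)
      then have "(G, Us) \<in> tucker_stationary_points ns rs (f \<circ> tucker_phi)" using crit GU by simp
      moreover have "(G, Us) \<in> full_rank_factors ns rs"
        using GU c left_inverse_imp_full_column_rank
        by (auto simp: full_rank_factors_def compatible_factors_def projection_factors_def)
      ultimately show "Z \<in> tucker_phi ` (tucker_stationary_points ns rs (f \<circ> tucker_phi) \<inter> full_rank_factors ns rs)"
        by (intro image_eqI[of _ _ "(G, Us)"]) (auto simp: tucker_phi_def Z)
    next
      fix Z
      assume "Z \<in> tucker_phi ` (tucker_stationary_points ns rs (f \<circ> tucker_phi) \<inter> full_rank_factors ns rs)"
      then obtain G Us where st: "(G, Us) \<in> tucker_stationary_points ns rs (f \<circ> tucker_phi)"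
        and fr: "(G, Us) \<in> full_rank_factors ns rs" and Z: "Z = multi_mode_prod G Us"
        by (auto simp: tucker_phi_def)
      have G: "G \<in> tensors rs" and lU: "length Us = length ns" using fr
        by (auto simp: full_rank_factors_def tucker_space_def)
      \<comment> \<open>Full column rank supplies the left inverses, hence a point of the manifold
        above the same tensor.\<close>
      have "\<exists>W. projection_factors (ns ! k) (rs ! k) (Us ! k) W" if "k < length ns" for k
      proof -
        have "Us ! k \<in> carrier_mat (ns ! k) (rs ! k)" "vec_space.rank (ns ! k) (Us ! k) = rs ! k"
          using fr that by (auto simp: full_rank_factors_def tucker_space_def)
        then show ?thesis using full_column_rank_projection_factors by blast
      qed
      then obtain W where "\<And>k. k < length ns \<Longrightarrow> projection_factors (ns ! k) (rs ! k) (Us ! k) (W k)" by metis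
      then have c: "compatible_factors ns rs Us (map W [0..<length ns])"
        using lU by (simp add: compatible_factors_def)
      from critical_imp_stationary[OF F len c G] st crit
      have "(Z, complement_projections ns Us (map W [0..<length ns])) \<in> stationary_points ns rs (f \<circ> phi)"
        by (simp add: Z)
      from imageI[OF this, of phi] show "Z \<in> phi ` stationary_points ns rs (f \<circ> phi)"
        by (simp add: phi_def)
    qed
  qed
qed

end
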